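(* Let $n \geq 2$ and let $f: \mathbb{Z}^2 \to \mathbb{P}^n$ be a Q-net. Then $f$ is a $2$-dimensional Koenigs net if and only if it admits (a $1$-parameter family of) touching inscribed conics. That is, being a $2$-dimensional Koenigs net is equivalent to admitting an instance of touching inscribed conics, and also to admitting a $1$-parameter family of touching inscribed conics.
   Context: All projective spaces are real. Lines in a projective plane are called generic if they are pairwise distinct and no three of them are concurrent. A planar quadrilateral $\Box(A,B,C,D)$ in $\mathbb{P}^n$ has four vertices lying in a plane, and its edge-lines $(A,B),(B,C),(C,D),(D,A)$ are generic in that plane; its diagonals are $(A,C)$ and $(B,D)$. Inscribed conics: a non-degenerate inscribed conic of $\Box(A,B,C,D)$ is a non-degenerate conic in the plane of the quadrilateral that is tangent to the four edge-lines at points (the tangency points) distinct from the vertices. In addition, exactly one degenerate conic counts as an inscribed conic: the double line supported on the line joining $(A,B)\cap(C,D)$ and $(B,C)\cap(D,A)$; its tangency points are its intersection points with the edge-lines. Q-net: a map $f:\mathbb{Z}^2\to\mathbb{P}^n$ such that for every $(i,j)$ the points $f_{i,j}, f_{i+1,j}, f_{i+1,j+1}, f_{i,j+1}$ are the vertices of a planar quadrilateral $\Box(f_{i,j}, f_{i+1,j}, f_{i+1,j+1}, f_{i,j+1})$. Two such quadrilaterals are neighbouring if they share an edge. Touching inscribed conics: an instance of touching inscribed conics is a choice of one inscribed conic in each quadrilateral such that, for any two neighbouring quadrilaterals, the two inscribed conics have the same tangency point on their common edge-line. The net admits a $1$-parameter family of touching inscribed conics if, for every edge and every point $p$ on the corresponding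 edge-line different from the two endpoints of the edge, there is exactly one instance of touching inscribed conics with tangency point $p$ on that edge-line. Koenigs nets: let $M_{i,j}$ be the intersection point of the diagonals of $\Box(f_{i,j}, f_{i+1,j}, f_{i+1,j+1}, f_{i,j+1})$. A Q-net $f$ is a $2$-dimensional Koenigs net if, in an affine chart containing all points involved, for all $(i,j)\in\mathbb{Z}^2$, $$\frac{l(M_{i,j}, f_{i+1,j})}{l(M_{i,j},f_{i,j+1})}\cdot\frac{l(M_{i-1,j}, f_{i,j+1})}{l(M_{i-1,j},f_{i-1,j})}\cdot\frac{l(M_{i-1,j-1},f_{i-1,j})}{l(M_{i-1,j-1},f_{i,j-1})}\cdot\frac{l(M_{i,j-1},f_{i,j-1})}{l(M_{i,j-1},f_{i+1,j})} = 1,$$ where $l(\cdot,\cdot)$ denotes oriented length along the relevant diagonal (each quotient is of oriented lengths on one line, hence independent of orientation). This condition is invariant under projective transformations. (Equivalently, in affine space, there is a Christoffel dual net $f^*$ whose quadrilaterals are dual to those of $f$: corresponding edge-lines are parallel and non-corresponding diagonals are parallel.) *)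

theory Defs
  imports "HOL-Analysis.Analysis"
begin

text \<open>The projective space of a real vector space of dimension \<open>n + 1\<close>: its points are the
  one-dimensional subspaces.  Projective lines and planes are represented by linear subspaces of
  dimension 2 and 3.\<close>

typedef (overloaded) ('a::euclidean_space) proj = "{L :: 'a set. subspace L \<and> dim L = 1}"
  morphisms subspace_of Abs_proj
proof -
  obtain b :: 'a where "b \<in> Basis"
    using nonempty_Basis by blast
  then have "subspace (span {b}) \<and> dim (span {b}) = 1"
    using nonzero_Basis[of b] by (simp add: dim_eq_card_independent)
  then show ?thesis
    by blast
qed

definition proj_line :: "'a::euclidean_space set \<Rightarrow> bool" where
  "proj_line L \<longleftrightarrow> subspace L \<and> dim L = 2"

definition proj_plane :: "'a::euclidean_space set \<Rightarrow> bool" where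
  "proj_plane E \<longleftrightarrow> subspace E \<and> dim E = 3"

definition incident :: "'a::euclidean_space proj \<Rightarrow> 'a set \<Rightarrow> bool" (infix "on" 50) where
  "p on S \<longleftrightarrow> subspace_of p \<subseteq> S"

definition join :: "'a::euclidean_space proj \<Rightarrow> 'a proj \<Rightarrow> 'a set" where
  "join A B = span (subspace_of A \<union> subspace_of B)"

definition meet :: "'a::euclidean_space set \<Rightarrow> 'a set \<Rightarrow> 'a proj" where
  "meet K L = (THE p. p on K \<and> p on L)"

definition generic_lines :: "'a::euclidean_space set list \<Rightarrow> bool" where
  "generic_lines Ls \<longleftrightarrow>
     (\<forall>L \<in> set Ls. proj_line L) \<and> distinct Ls \<and>
     (\<forall>K \<in> set Ls. \<forall>L \<in> set Ls. \<forall>M \<in> set Ls. K \<noteq> L \<and> L \<noteq> M \<and> K \<noteq> M \<longrightarrow>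
        \<not> (\<exists>p. p on K \<and> p on L \<and> p on M))"

definition edge_lines ::
  "'a::euclidean_space proj \<Rightarrow> 'a proj \<Rightarrow> 'a proj \<Rightarrow> 'a proj \<Rightarrow> 'a set list" where
  "edge_lines A B C D = [join A B, join B C, join C D, join D A]"

definition planar_quad ::
  "'a::euclidean_space proj \<Rightarrow> 'a proj \<Rightarrow> 'a proj \<Rightarrow> 'a proj \<Rightarrow> bool" where
  "planar_quad A B C D \<longleftrightarrow>
     (\<exists>E. proj_plane E \<and> A on E \<and> B on E \<and> C on E \<and> D on E) \<and>
     generic_lines (edge_lines A B C D)"

definition quad_plane ::
  "'a::euclidean_space proj \<Rightarrow> 'a proj \<Rightarrow> 'a proj \<Rightarrow> 'a proj \<Rightarrow> 'a set" where
  "quad_plane A B C D =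
     span (subspace_of A \<union> subspace_of B \<union> subspace_of C \<union> subspace_of D)"

definition diag_point ::
  "'a::euclidean_space proj \<Rightarrow> 'a proj \<Rightarrow> 'a proj \<Rightarrow> 'a proj \<Rightarrow> 'a proj" where
  "diag_point A B C D = meet (join A C) (join B D)"

text \<open>A conic in the plane \<open>E\<close> is a nonzero quadratic form on \<open>E\<close> up to nonzero real factors.  It
  is represented by the set of all these forms, each set to 0 outside \<open>E\<close>, so that equality of
  conics is equality of sets.\<close>

type_synonym 'a conic = "('a \<Rightarrow> real) set"

definition quadratic_form :: "('a::euclidean_space \<Rightarrow> real) \<Rightarrow> bool" where
  "quadratic_form q \<longleftrightarrow> (\<exists>B. bilinear B \<and> (\<forall>x. q x = B x x))"

definition polar :: "('a::euclidean_space \<Rightarrow> real) \<Rightarrow> 'a \<Rightarrow> 'a \<Rightarrow> real" where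
  "polar q x y = (q (x + y) - q x - q y) / 2"

definition conic_of :: "'a::euclidean_space set \<Rightarrow> ('a \<Rightarrow> real) \<Rightarrow> 'a conic" where
  "conic_of E q = {(\<lambda>x. if x \<in> E then c * q x else 0) | c. c \<noteq> 0}"

definition conic_in :: "'a::euclidean_space set \<Rightarrow> 'a conic \<Rightarrow> bool" where
  "conic_in E \<C> \<longleftrightarrow> (\<exists>q. quadratic_form q \<and> (\<exists>x \<in> E. q x \<noteq> 0) \<and> \<C> = conic_of E q)"

definition nondegenerate_conic :: "'a::euclidean_space set \<Rightarrow> 'a conic \<Rightarrow> bool" where
  "nondegenerate_conic E \<C> \<longleftrightarrow>
     conic_in E \<C> \<and> (\<forall>q \<in> \<C>. \<forall>x \<in> E. (\<forall>y \<in> E. polar q x y = 0) \<longrightarrow> x = 0)"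

definition double_line :: "'a::euclidean_space set \<Rightarrow> 'a set \<Rightarrow> 'a conic \<Rightarrow> bool" where
  "double_line E L \<C> \<longleftrightarrow>
     (\<exists>g. linear g \<and> L = {x \<in> E. g x = 0} \<and> \<C> = conic_of E (\<lambda>x. (g x)\<^sup>2))"

definition on_conic :: "'a::euclidean_space proj \<Rightarrow> 'a conic \<Rightarrow> bool" where
  "on_conic p \<C> \<longleftrightarrow> (\<forall>q \<in> \<C>. \<forall>x \<in> subspace_of p. q x = 0)"

text \<open>The tangent line of a non-degenerate conic at one of its points is the polar of that
  point.\<close>

definition tangent_at ::
  "'a::euclidean_space set \<Rightarrow> 'a conic \<Rightarrow> 'a set \<Rightarrow> 'a proj \<Rightarrow> bool" where
  "tangent_at E \<C> L p \<longleftrightarrow>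
     p on E \<and> on_conic p \<C> \<and>
     L = {y \<in> E. \<forall>q \<in> \<C>. \<forall>x \<in> subspace_of p. polar q x y = 0}"

definition nondeg_inscribed ::
  "'a::euclidean_space proj \<Rightarrow> 'a proj \<Rightarrow> 'a proj \<Rightarrow> 'a proj \<Rightarrow> 'a conic \<Rightarrow> bool" where
  "nondeg_inscribed A B C D \<C> \<longleftrightarrow>
     nondegenerate_conic (quad_plane A B C D) \<C> \<and>
     (\<forall>L \<in> set (edge_lines A B C D).
        \<exists>p. tangent_at (quad_plane A B C D) \<C> L p \<and> p \<notin> {A, B, C, D})"

definition deg_inscribed ::
  "'a::euclidean_space proj \<Rightarrow> 'a proj \<Rightarrow> 'a proj \<Rightarrow> 'a proj \<Rightarrow> 'a conic \<Rightarrow> bool" where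
  "deg_inscribed A B C D \<C> \<longleftrightarrow>
     double_line (quad_plane A B C D)
       (join (meet (join A B) (join C D)) (meet (join B C) (join D A))) \<C>"

definition inscribed ::
  "'a::euclidean_space proj \<Rightarrow> 'a proj \<Rightarrow> 'a proj \<Rightarrow> 'a proj \<Rightarrow> 'a conic \<Rightarrow> bool" where
  "inscribed A B C D \<C> \<longleftrightarrow> nondeg_inscribed A B C D \<C> \<or> deg_inscribed A B C D \<C>"

text \<open>\<open>p\<close> is the tangency point of the inscribed conic \<open>\<C>\<close> on the edge-line \<open>L\<close>.\<close>

definition tangency_point ::
  "'a::euclidean_space proj \<Rightarrow> 'a proj \<Rightarrow> 'a proj \<Rightarrow> 'a proj \<Rightarrow>
   'a conic \<Rightarrow> 'a set \<Rightarrow> 'a proj \<Rightarrow> bool" where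
  "tangency_point A B C D \<C> L p \<longleftrightarrow>
     L \<in> set (edge_lines A B C D) \<and>
     (nondeg_inscribed A B C D \<C> \<and> tangent_at (quad_plane A B C D) \<C> L p \<or>
      deg_inscribed A B C D \<C> \<and> p on L \<and> on_conic p \<C>)"

type_synonym 'a net = "int \<Rightarrow> int \<Rightarrow> 'a proj"

text \<open>The quadrilateral with index \<open>(i, j)\<close> has the vertices
  \<open>f i j\<close>, \<open>f (i+1) j\<close>, \<open>f (i+1) (j+1)\<close>, \<open>f i (j+1)\<close>, in this cyclic order.\<close>

abbreviation at_quad ::
  "('a::euclidean_space proj \<Rightarrow> 'a proj \<Rightarrow> 'a proj \<Rightarrow> 'a proj \<Rightarrow> 'b) \<Rightarrow> 'a net \<Rightarrow> int \<Rightarrow> int \<Rightarrow> 'b"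
  where "at_quad P f i j \<equiv> P (f i j) (f (i+1) j) (f (i+1) (j+1)) (f i (j+1))"

definition q_net :: "'a::euclidean_space net \<Rightarrow> bool" where
  "q_net f \<longleftrightarrow> (\<forall>i j. at_quad planar_quad f i j)"

definition h_line :: "'a::euclidean_space net \<Rightarrow> int \<Rightarrow> int \<Rightarrow> 'a set" where
  "h_line f i j = join (f i j) (f (i+1) j)"

definition v_line :: "'a::euclidean_space net \<Rightarrow> int \<Rightarrow> int \<Rightarrow> 'a set" where
  "v_line f i j = join (f i j) (f i (j+1))"

text \<open>\<open>p\<close> is the common tangency point, on the edge-line from \<open>f i j\<close> to \<open>f (i+1) j\<close> respectively
  \<open>f i (j+1)\<close>, of the conics chosen in the two quadrilaterals that share this edge.\<close>

definition h_touch ::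
  "'a::euclidean_space net \<Rightarrow> (int \<Rightarrow> int \<Rightarrow> 'a conic) \<Rightarrow> int \<Rightarrow> int \<Rightarrow> 'a proj \<Rightarrow> bool" where
  "h_touch f \<C> i j p \<longleftrightarrow>
     at_quad tangency_point f i j (\<C> i j) (h_line f i j) p \<and>
     at_quad tangency_point f i (j-1) (\<C> i (j-1)) (h_line f i j) p"

definition v_touch ::
  "'a::euclidean_space net \<Rightarrow> (int \<Rightarrow> int \<Rightarrow> 'a conic) \<Rightarrow> int \<Rightarrow> int \<Rightarrow> 'a proj \<Rightarrow> bool" where
  "v_touch f \<C> i j p \<longleftrightarrow>
     at_quad tangency_point f i j (\<C> i j) (v_line f i j) p \<and>
     at_quad tangency_point f (i-1) j (\<C> (i-1) j) (v_line f i j) p"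

definition touching_inscribed_conics ::
  "'a::euclidean_space net \<Rightarrow> (int \<Rightarrow> int \<Rightarrow> 'a conic) \<Rightarrow> bool" where
  "touching_inscribed_conics f \<C> \<longleftrightarrow>
     (\<forall>i j. at_quad inscribed f i j (\<C> i j)) \<and>
     (\<forall>i j. \<exists>p. h_touch f \<C> i j p) \<and>
     (\<forall>i j. \<exists>p. v_touch f \<C> i j p)"

definition admits_touching_family :: "'a::euclidean_space net \<Rightarrow> bool" where
  "admits_touching_family f \<longleftrightarrow>
     (\<forall>i j p. p on h_line f i j \<and> p \<noteq> f i j \<and> p \<noteq> f (i+1) j \<longrightarrow>
        (\<exists>!\<C>. touching_inscribed_conics f \<C> \<and> h_touch f \<C> i j p)) \<and>
     (\<forall>i j p. p on v_line f i j \<and> p \<noteq> f i j \<and> p \<noteq> f i (j+1) \<longrightarrow>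
        (\<exists>!\<C>. touching_inscribed_conics f \<C> \<and> v_touch f \<C> i j p))"

text \<open>A nonzero linear functional \<open>h\<close> gives the affine chart that consists of the points off the
  hyperplane \<open>h = 0\<close>, identified with the affine hyperplane \<open>h = 1\<close>.\<close>

definition in_chart :: "('a::euclidean_space \<Rightarrow> real) \<Rightarrow> 'a proj \<Rightarrow> bool" where
  "in_chart h p \<longleftrightarrow> (\<exists>x \<in> subspace_of p. h x \<noteq> 0)"

definition affine_point :: "('a::euclidean_space \<Rightarrow> real) \<Rightarrow> 'a proj \<Rightarrow> 'a" where
  "affine_point h p = (THE x. x \<in> subspace_of p \<and> h x = 1)"

text \<open>Oriented length from \<open>x\<close> to \<open>y\<close> along a line with unit direction vector \<open>u\<close>.\<close>

definition oriented_length :: "'a::euclidean_space \<Rightarrow> 'a \<Rightarrow> 'a \<Rightarrow> real" where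
  "oriented_length u x y = (y - x) \<bullet> u"

text \<open>\<open>l(M, A) / l(M, B)\<close> in the chart \<open>h\<close>, for \<open>M\<close> on the line through \<open>A\<close> and \<open>B\<close>, which is
  oriented from \<open>A\<close> to \<open>B\<close>.\<close>

definition length_quotient ::
  "('a::euclidean_space \<Rightarrow> real) \<Rightarrow> 'a proj \<Rightarrow> 'a proj \<Rightarrow> 'a proj \<Rightarrow> real" where
  "length_quotient h M A B =
     (let u = sgn (affine_point h B - affine_point h A) in
        oriented_length u (affine_point h M) (affine_point h A) /
        oriented_length u (affine_point h M) (affine_point h B))"

definition koenigs_net :: "'a::euclidean_space net \<Rightarrow> bool" where
  "koenigs_net f \<longleftrightarrow> q_net f \<and>
     (let M = at_quad diag_point f in
      \<exists>h. linear h \<and> (\<forall>i j. in_chart h (f i j) \<and> in_chart h (M i j)) \<and>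
        (\<forall>i j.
           length_quotient h (M i j) (f (i+1) j) (f i (j+1)) *
           length_quotient h (M (i-1) j) (f i (j+1)) (f (i-1) j) *
           length_quotient h (M (i-1) (j-1)) (f (i-1) j) (f i (j-1)) *
           length_quotient h (M i (j-1)) (f i (j-1)) (f (i+1) j) = 1))"

end

theory Submission
  imports Defs
begin

text \<open>
  The theorem reduces to one fact about a single quadrilateral and one about recurrences on
  \<open>\<int>\<^sup>2\<close>.

  \<^emph>\<open>One quadrilateral.\<close> No three vertices are collinear, so vectors \<open>a, b, c, d\<close> that represent
  them satisfy a linear relation without zero coefficients, and they can be scaled so that
  \<open>a + c = k (b + d)\<close>.  An edge-line touches a conic \<open>q = 0\<close> away from its two vertices iff \<open>q\<close> is
  up to sign the square of a linear form there that vanishes at neither vertex.  Once \<open>q\<close>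
  and the vertices are rescaled so that \<open>q\<close> takes the value 1 at each of them, the linear form on the line of
  \<open>a\<close> and \<open>b\<close> is \<open>x + y\<close> in the coordinates of \<open>x a + y b\<close>, after a choice of the sign of \<open>b\<close>, and
  the tangency point is \<open>a - b\<close>.  Going once around the quadrilateral fixes all signs but one, and
  the relation between the vertices then decides everything: the last sign is consistent, and the
  rescaled vertices are \<open>a, r b, c, r d\<close> up to a common factor
  (\<open>tangency_signs_and_scales\<close>).  Hence the inscribed conics form a family with one parameter
  \<open>r \<noteq> 0\<close>, in which the double line sits at \<open>r = k\<close>, and the parameter determines the four
  tangency points (\<open>inscribed_iff_ratio_conic\<close>, \<open>ratio_conic_tangency_points\<close>).

  \<^emph>\<open>The net.\<close> Two neighbouring conics touch on their common edge iff the product of their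
  parameters is a certain nonzero constant of the net.  So instances of touching inscribed conics
  are the functions on \<open>\<int>\<^sup>2\<close> whose products of horizontal and of vertical neighbours are prescribed
  (\<open>touching_iff_inverting_grid\<close>).  Such a function is determined by a single value, and one with
  any given nonzero value exists as soon as the two ways around each elementary square agree.
  The oriented length quotients of the Koenigs condition are, up to chart factors that cancel at
  each vertex, quotients of the coefficients of the linear relations, so the Koenigs condition is
  exactly this compatibility (\<open>koenigs_net_iff_compatible\<close>).  One instance therefore already forces
  compatibility, and compatibility yields the whole family.
\<close>

section \<open>Representing vectors\<close>

definition represents :: "'a::euclidean_space \<Rightarrow> 'a proj \<Rightarrow> bool" where
  "represents v p \<longleftrightarrow> v \<noteq> 0 \<and> subspace_of p = span {v}"

definition point_of :: "'a::euclidean_space \<Rightarrow> 'a proj" where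
  "point_of v = Abs_proj (span {v})"

lemma represents_point_of:
  assumes "v \<noteq> 0"
  shows "represents v (point_of v)"
  using assms by (simp add: represents_def point_of_def Abs_proj_inverse dim_singleton)

lemma represents_iff: "represents v p \<longleftrightarrow> v \<noteq> 0 \<and> p = point_of v"
  by (metis represents_def represents_point_of subspace_of_inject)

lemma ex_represents: "\<exists>v. represents v p"
proof -
  have p: "subspace (subspace_of p)" "dim (subspace_of p) = 1"
    using subspace_of[of p] by auto
  then obtain v where v: "v \<in> subspace_of p" "v \<noteq> 0"
    by (metis dim_eq_0 subset_iff singletonI subsetI zero_neq_one)
  have "span {v} = subspace_of p"
    by (rule subspace_dim_equal) (use p v in \<open>auto simp: span_minimal dim_singleton\<close>)
  with v show ?thesis
    by (auto simp: represents_def)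
qed

lemma represents_scale: "represents v p \<Longrightarrow> s \<noteq> 0 \<Longrightarrow> represents (s *\<^sub>R v) p"
  using span_image_scale[of "{v}" "\<lambda>_. s"] by (simp add: represents_def)

lemma point_of_eq_iff:
  assumes "v \<noteq> 0" "w \<noteq> 0"
  shows "point_of v = point_of w \<longleftrightarrow> (\<exists>s. w = s *\<^sub>R v)"
proof
  assume "point_of v = point_of w"
  then have "w \<in> span {v}"
    by (metis assms represents_def represents_point_of span_base singletonI)
  then show "\<exists>s. w = s *\<^sub>R v"
    by (auto simp: span_singleton)
next
  assume "\<exists>s. w = s *\<^sub>R v"
  then show "point_of v = point_of w"
    by (metis assms represents_iff represents_point_of represents_scale scaleR_zero_left)
qed

lemma on_subspace_iff:
  assumes "represents v p" "subspace S"
  shows "p on S \<longleftrightarrow> v \<in> S"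
  using assms span_minimal[of "{v}" S] span_base[of v "{v}"]
  by (auto simp: incident_def represents_def)

lemma mem_span_pair: "v \<in> span {a, b} \<longleftrightarrow> (\<exists>x y. v = x *\<^sub>R a + y *\<^sub>R b)"
proof -
  have "v \<in> span {a, b} \<longleftrightarrow> (\<exists>x y. v - x *\<^sub>R a = y *\<^sub>R b)"
    unfolding span_insert[of a "{b}"] mem_Collect_eq span_singleton by auto
  also have "\<dots> \<longleftrightarrow> (\<exists>x y. v = x *\<^sub>R a + y *\<^sub>R b)"
    by (simp add: diff_eq_eq add.commute)
  finally show ?thesis .
qed

lemma mem_span_triple:
  "v \<in> span {a, b, c} \<longleftrightarrow> (\<exists>x y z. v = x *\<^sub>R a + y *\<^sub>R b + z *\<^sub>R c)"
proof -
  have "v \<in> span {a, b, c} \<longleftrightarrow> (\<exists>x y z. v - x *\<^sub>R a = y *\<^sub>R b + z *\<^sub>R c)"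
    unfolding span_insert[of a "{b, c}"] mem_Collect_eq mem_span_pair ..
  also have "\<dots> \<longleftrightarrow> (\<exists>x y z. v = x *\<^sub>R a + y *\<^sub>R b + z *\<^sub>R c)"
    by (simp add: diff_eq_eq ac_simps)
  finally show ?thesis .
qed

lemma join_eq_span:
  assumes "represents a A" "represents b B"
  shows "join A B = span {a, b}"
proof -
  have "span (span {a} \<union> span {b}) = span ({a} \<union> {b})"
    unfolding span_Un span_span ..
  with assms show ?thesis
    by (simp add: join_def represents_def insert_commute)
qed

lemma join_commute: "join A B = join B A"
  by (simp add: join_def Un_commute)

lemma meet_commute: "meet K L = meet L K"
  unfolding meet_def by (simp add: conj_commute)

lemma meet_eqI:
  assumes "subspace K" "subspace L" "v \<noteq> 0" "K \<inter> L = span {v}"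
  shows "meet K L = point_of v"
  unfolding meet_def
proof (rule the_equality)
  have "v \<in> K \<inter> L"
    using assms(4) by (simp add: span_base)
  then show "point_of v on K \<and> point_of v on L"
    using assms on_subspace_iff[OF represents_point_of[OF assms(3)]] by auto
next
  fix p assume p: "p on K \<and> p on L"
  obtain w where w: "represents w p"
    using ex_represents by blast
  then have "w \<in> span {v}"
    using p assms(1,2,4) on_subspace_iff[OF w] by blast
  then obtain s where "w = s *\<^sub>R v"
    by (auto simp: span_singleton)
  with w assms(3) show "p = point_of v"
    by (metis point_of_eq_iff represents_iff)
qed

section \<open>Quadratic forms and their polar forms\<close>

lemma polar_commute: "polar q x y = polar q y x"
  by (simp add: polar_def add.commute)

lemma bilinear_polar:
  assumes "quadratic_form q"
  shows "bilinear (polar q)"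
proof -
  obtain B where B: "bilinear B" "\<And>x. q x = B x x"
    using assms by (auto simp: quadratic_form_def)
  have eq: "polar q x y = (B x y + B y x) / 2" for x y
    by (simp add: polar_def B bilinear_ladd bilinear_radd)
  show ?thesis
    unfolding bilinear_def
    by (auto intro!: linearI simp: eq B(1) bilinear_ladd bilinear_radd bilinear_lmul
        bilinear_rmul algebra_simps add_divide_distrib)
qed

lemma polar_self:
  assumes "quadratic_form q"
  shows "polar q x x = q x"
proof -
  obtain B where B: "bilinear B" "\<And>x. q x = B x x"
    using assms by (auto simp: quadratic_form_def)
  show ?thesis
    by (simp add: polar_def B bilinear_ladd bilinear_radd)
qed

lemma polar_linear:
  assumes "quadratic_form q"
  shows "polar q (x + y) z = polar q x z + polar q y z"
    "polar q z (x + y) = polar q z x + polar q z y"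
    "polar q (x - y) z = polar q x z - polar q y z"
    "polar q z (x - y) = polar q z x - polar q z y"
    "polar q (s *\<^sub>R x) z = s * polar q x z"
    "polar q z (s *\<^sub>R x) = s * polar q z x"
  using bilinear_polar[OF assms]
  by (simp_all add: bilinear_ladd bilinear_radd bilinear_lmul bilinear_rmul bilinear_lsub
      bilinear_rsub)

lemma quadratic_form_scale:
  assumes "quadratic_form q"
  shows "q (s *\<^sub>R x) = s\<^sup>2 * q x"
  using polar_linear(5,6)[OF assms] polar_self[OF assms] by (metis mult.assoc power2_eq_square)

lemma quadratic_form_cmult:
  assumes "quadratic_form q"
  shows "quadratic_form (\<lambda>x. c * q x)"
proof -
  obtain B where B: "bilinear B" "\<And>x. q x = B x x"
    using assms by (auto simp: quadratic_form_def)
  have "bilinear (\<lambda>x y. c * B x y)"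
    unfolding bilinear_def
    by (auto intro!: linearI simp: B(1) bilinear_ladd bilinear_radd bilinear_lmul
        bilinear_rmul algebra_simps)
  with B(2) show ?thesis
    unfolding quadratic_form_def by (intro exI[of _ "\<lambda>x y. c * B x y"]) simp
qed

lemma polar_cmult: "polar (\<lambda>x. c * q x) x y = c * polar q x y"
  by (simp add: polar_def algebra_simps)

lemma quadratic_form_mult:
  assumes "linear g" "linear h"
  shows "quadratic_form (\<lambda>x. g x * h x)"
  unfolding quadratic_form_def bilinear_def using assms
  by (intro exI[of _ "\<lambda>x y. g x * h y"])
     (auto intro!: linearI simp: linear_add linear_cmul algebra_simps)

lemma quadratic_form_add:
  assumes "quadratic_form p" "quadratic_form q"
  shows "quadratic_form (\<lambda>x. p x + q x)"
proof -
  obtain B C where "bilinear B" "\<And>x. p x = B x x" "bilinear C" "\<And>x. q x = C x x"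
    using assms by (auto simp: quadratic_form_def)
  then show ?thesis
    unfolding quadratic_form_def bilinear_def
    by (intro exI[of _ "\<lambda>x y. B x y + C x y"]) (auto intro!: linear_compose_add)
qed

section \<open>Conics\<close>

lemma conic_of_cong:
  assumes "s \<noteq> 0" "\<And>x. x \<in> E \<Longrightarrow> q' x = s * q x"
  shows "conic_of E q' = conic_of E q"
proof -
  have "(\<lambda>x. if x \<in> E then c * q' x else 0) \<in> conic_of E q" if "c \<noteq> 0" for c
    unfolding conic_of_def using that assms by (intro CollectI exI[of _ "c * s"]) auto
  moreover have "(\<lambda>x. if x \<in> E then c * q x else 0) \<in> conic_of E q'" if "c \<noteq> 0" for c
    unfolding conic_of_def using that assms by (intro CollectI exI[of _ "c / s"]) auto
  ultimately show ?thesis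
    unfolding conic_of_def[of E q'] conic_of_def[of E q] by (auto simp: conic_of_def)
qed

lemma self_in_conic_of: "(\<lambda>x. if x \<in> E then q x else 0) \<in> conic_of E q"
  unfolding conic_of_def by (auto intro!: exI[of _ 1])

text \<open>The members of a conic are set to 0 outside the plane and so need not be quadratic forms, but
  on the plane their polar forms are multiples of that of any form that defines the conic.\<close>

lemma polar_conic_of:
  assumes "subspace E" "q' \<in> conic_of E q"
  shows "\<exists>c. c \<noteq> 0 \<and> (\<forall>x\<in>E. \<forall>y\<in>E. polar q' x y = c * polar q x y)"
proof -
  obtain c where "c \<noteq> 0" "q' = (\<lambda>x. if x \<in> E then c * q x else 0)"
    using assms(2) by (auto simp: conic_of_def)
  with assms(1) show ?thesis
    by (intro exI[of _ c]) (auto simp: polar_def subspace_add algebra_simps)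
qed

lemma polar_restrict:
  assumes "subspace E" "x \<in> E" "y \<in> E"
  shows "polar (\<lambda>x. if x \<in> E then q x else 0) x y = polar q x y"
  using assms by (auto simp: polar_def subspace_add)

lemma on_conic_of_iff:
  assumes "quadratic_form q" "represents v p" "v \<in> E" "subspace E"
  shows "on_conic p (conic_of E q) \<longleftrightarrow> q v = 0"
proof
  assume on: "on_conic p (conic_of E q)"
  have "v \<in> subspace_of p"
    using assms(2) by (simp add: represents_def span_base)
  then have "(\<lambda>x. if x \<in> E then q x else 0) v = 0"
    by (rule bspec[OF bspec[OF on[unfolded on_conic_def] self_in_conic_of]])
  with assms(3) show "q v = 0" by simp
next
  assume "q v = 0"
  with assms show "on_conic p (conic_of E q)"
    by (auto simp: on_conic_def represents_def conic_of_def span_singleton quadratic_form_scale)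
qed

lemma tangent_at_conic_of_iff:
  assumes "quadratic_form q" "represents v p" "subspace E"
  shows "tangent_at E (conic_of E q) L p \<longleftrightarrow>
    v \<in> E \<and> q v = 0 \<and> L = {y \<in> E. polar q v y = 0}"
proof (cases "v \<in> E")
  case True
  have "(\<forall>q'\<in>conic_of E q. \<forall>x\<in>subspace_of p. polar q' x y = 0) \<longleftrightarrow> polar q v y = 0"
    if y: "y \<in> E" for y
  proof
    assume polar_0: "\<forall>q'\<in>conic_of E q. \<forall>x\<in>subspace_of p. polar q' x y = 0"
    have "v \<in> subspace_of p"
      using assms(2) by (simp add: represents_def span_base)
    then have "polar (\<lambda>x. if x \<in> E then q x else 0) v y = 0"
      by (rule bspec[OF bspec[OF polar_0 self_in_conic_of]])
    with y True assms(3) show "polar q v y = 0"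
      by (simp add: polar_restrict)
  next
    assume 0: "polar q v y = 0"
    show "\<forall>q'\<in>conic_of E q. \<forall>x\<in>subspace_of p. polar q' x y = 0"
    proof (intro ballI)
      fix q' x assume q': "q' \<in> conic_of E q" and "x \<in> subspace_of p"
      then obtain s where x: "x = s *\<^sub>R v"
        using assms(2) by (auto simp: represents_def span_singleton)
      obtain c where "\<forall>x\<in>E. \<forall>y\<in>E. polar q' x y = c * polar q x y"
        using polar_conic_of[OF assms(3) q'] by blast
      then have "polar q' x y = c * polar q (s *\<^sub>R v) y"
        using x y True assms(3) by (simp add: subspace_scale)
      with 0 show "polar q' x y = 0"
        by (simp add: polar_linear[OF assms(1)])
    qed
  qed
  then have "{y \<in> E. \<forall>q'\<in>conic_of E q. \<forall>x\<in>subspace_of p. polar q' x y = 0}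
      = {y \<in> E. polar q v y = 0}"
    by blast
  with True show ?thesis
    unfolding tangent_at_def
    using on_subspace_iff[OF assms(2,3)] on_conic_of_iff[OF assms(1,2) True assms(3)] by simp
next
  case False
  then show ?thesis
    unfolding tangent_at_def using on_subspace_iff[OF assms(2,3)] by simp
qed

lemma nondegenerate_conic_of_iff:
  assumes "quadratic_form q" "subspace E" "E \<noteq> {0}"
  shows "nondegenerate_conic E (conic_of E q) \<longleftrightarrow>
    (\<forall>x\<in>E. (\<forall>y\<in>E. polar q x y = 0) \<longrightarrow> x = 0)" (is "_ \<longleftrightarrow> ?nondeg")
proof
  assume n: "nondegenerate_conic E (conic_of E q)"
  then have "\<forall>x\<in>E. (\<forall>y\<in>E. polar (\<lambda>x. if x \<in> E then q x else 0) x y = 0) \<longrightarrow> x = 0"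
    unfolding nondegenerate_conic_def using bspec[OF _ self_in_conic_of] by blast
  then show ?nondeg
    by (simp add: polar_restrict[OF assms(2)])
next
  assume n: ?nondeg
  have "\<exists>x\<in>E. q x \<noteq> 0"
  proof (rule ccontr)
    assume "\<not> ?thesis"
    then have "\<forall>x\<in>E. \<forall>y\<in>E. polar q x y = 0"
      using assms(2) by (auto simp: polar_def subspace_add)
    with n have "E \<subseteq> {0}" by auto
    with assms(2,3) show False
      using subspace_0 by blast
  qed
  then have "conic_in E (conic_of E q)"
    using assms(1) unfolding conic_in_def by blast
  moreover have "x = 0" if "q' \<in> conic_of E q" "x \<in> E" "\<forall>y\<in>E. polar q' x y = 0" for q' x
    using polar_conic_of[OF assms(2) that(1)] that(2,3) n by fastforce
  ultimately show "nondegenerate_conic E (conic_of E q)"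
    unfolding nondegenerate_conic_def by blast
qed

section \<open>Quadrilaterals in normalised coordinates\<close>

text \<open>The normal form of an inscribed conic.  The values prescribed on two adjacent vertices make \<open>q\<close>
  the square \<open>(x + y)\<^sup>2\<close> on the edge-line through them, so the conic touches this line at the
  difference of the two vertices.\<close>

definition adapted :: "('a::euclidean_space \<Rightarrow> real) \<Rightarrow> 'a \<Rightarrow> 'a \<Rightarrow> 'a \<Rightarrow> 'a \<Rightarrow> bool" where
  "adapted q a b c d \<longleftrightarrow> quadratic_form q \<and> q a = 1 \<and> q b = 1 \<and> q c = 1 \<and> q d = 1 \<and>
     polar q a b = 1 \<and> polar q b c = 1 \<and> polar q c d = 1 \<and> polar q d a = 1"

lemma quad_plane_rotate: "quad_plane B C D A = quad_plane A B C D"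
  by (simp add: quad_plane_def Un_ac)

lemma nondeg_inscribed_rotate: "nondeg_inscribed B C D A \<C> \<longleftrightarrow> nondeg_inscribed A B C D \<C>"
  unfolding nondeg_inscribed_def quad_plane_rotate[of B C D A] edge_lines_def by auto

lemma deg_inscribed_rotate: "deg_inscribed B C D A \<C> \<longleftrightarrow> deg_inscribed A B C D \<C>"
  unfolding deg_inscribed_def quad_plane_rotate[of B C D A]
  by (simp add: join_commute[of "meet (join B C) (join D A)"] meet_commute[of "join C D"])

lemma tangency_point_rotate:
  "tangency_point B C D A \<C> L p \<longleftrightarrow> tangency_point A B C D \<C> L p"
  unfolding tangency_point_def nondeg_inscribed_rotate[of B C D A] deg_inscribed_rotate[of B C D A]
    quad_plane_rotate[of B C D A] edge_lines_def by auto

text \<open>The vertices enter only up to individual factors; these are chosen so that the single linear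
  relation between the four vectors becomes symmetric in opposite vertices.  What freedom remains,
  apart from a common factor, is a common factor of \<open>b\<close> and \<open>d\<close>, and it is this factor that
  parametrises the inscribed conics.  Rotating the labels replaces \<open>k\<close> by its inverse, so it
  suffices to treat the edge \<open>A B\<close> everywhere.\<close>

locale quad_frame =
  fixes A B C D :: "'a::euclidean_space proj" and a b c d :: 'a and k :: real
  assumes represents_vertices:
      "represents a A" "represents b B" "represents c C" "represents d D"
    and indep: "\<And>x y z. x *\<^sub>R a + y *\<^sub>R b + z *\<^sub>R c = 0 \<Longrightarrow> x = 0 \<and> y = 0 \<and> z = 0"
    and diagonal_relation: "a + c = k *\<^sub>R (b + d)"
begin

lemma k_nonzero: "k \<noteq> 0"
  using indep[of 1 0 1] diagonal_relation by auto

lemma d_eq: "d = (1 / k) *\<^sub>R a - b + (1 / k) *\<^sub>R c"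
proof -
  have "(1 / k) *\<^sub>R (a + c) = b + d"
    using k_nonzero by (simp add: diagonal_relation)
  then show ?thesis
    by (simp add: algebra_simps)
qed

lemma coordinates_eq:
  assumes "x *\<^sub>R a + y *\<^sub>R b + z *\<^sub>R c = x' *\<^sub>R a + y' *\<^sub>R b + z' *\<^sub>R c"
  shows "x = x' \<and> y = y' \<and> z = z'"
  using indep[of "x - x'" "y - y'" "z - z'"] assms by (simp add: algebra_simps)

lemma rotate: "quad_frame B C D A b c d a (1 / k)"
proof
  fix x y z :: real
  assume "x *\<^sub>R b + y *\<^sub>R c + z *\<^sub>R d = 0"
  then have "(z / k) *\<^sub>R a + (x - z) *\<^sub>R b + (y + z / k) *\<^sub>R c = 0"
    by (simp add: d_eq algebra_simps)
  from indep[OF this] k_nonzero show "x = 0 \<and> y = 0 \<and> z = 0"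
    by auto
next
  show "b + d = (1 / k) *\<^sub>R (c + a)"
    using diagonal_relation k_nonzero by (simp add: add.commute)
qed (use represents_vertices in auto)

lemma rescale:
  assumes "r \<noteq> 0"
  shows "quad_frame A B C D a (r *\<^sub>R b) c (r *\<^sub>R d) (k / r)"
proof
  fix x y z :: real
  assume "x *\<^sub>R a + y *\<^sub>R r *\<^sub>R b + z *\<^sub>R c = 0"
  then show "x = 0 \<and> y = 0 \<and> z = 0"
    using indep[of x "y * r" z] assms by simp
next
  show "a + c = (k / r) *\<^sub>R (r *\<^sub>R b + r *\<^sub>R d)"
    using diagonal_relation assms by (simp add: algebra_simps)
qed (use represents_vertices represents_scale assms in auto)

abbreviation E :: "'a set" where "E \<equiv> quad_plane A B C D"

lemma E_eq: "E = span {a, b, c}"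
proof -
  have "span ({a} \<union> {b} \<union> {c} \<union> {d}) = span (span {a} \<union> span {b} \<union> span {c} \<union> span {d})"
    by (simp only: span_Un span_span)
  then have "span (span {a} \<union> span {b} \<union> span {c} \<union> span {d}) = span {a, b, c, d}"
    by (simp add: insert_commute)
  moreover have "d \<in> span {a, b, c}"
    unfolding d_eq by (intro span_add span_diff span_scale span_base) auto
  then have "span {a, b, c, d} = span {a, b, c}"
    using span_redundant[of d "{a, b, c}"] by (simp add: insert_commute)
  ultimately show ?thesis
    using represents_vertices by (simp add: quad_plane_def represents_def)
qed

lemma subspace_E: "subspace E"
  by (simp add: E_eq)

lemma mem_E_iff: "v \<in> E \<longleftrightarrow> (\<exists>x y z. v = x *\<^sub>R a + y *\<^sub>R b + z *\<^sub>R c)"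
  by (simp add: E_eq mem_span_triple)

lemma vertices_in_E: "a \<in> E" "b \<in> E" "c \<in> E" "d \<in> E"
proof -
  show "a \<in> E" "b \<in> E" "c \<in> E"
    by (auto simp: E_eq intro: span_base)
  then show "d \<in> E"
    unfolding d_eq by (intro subspace_add subspace_diff subspace_scale subspace_E)
qed

lemma E_nonzero: "E \<noteq> {0}"
  using vertices_in_E(1) represents_vertices(1) by (auto simp: represents_def)

lemma mem_join_iff: "v \<in> join A B \<longleftrightarrow> (\<exists>x y. v = x *\<^sub>R a + y *\<^sub>R b)"
  unfolding join_eq_span[OF represents_vertices(1,2)] mem_span_pair ..

lemma edge_combination_trivial: "x *\<^sub>R a - y *\<^sub>R b = 0 \<Longrightarrow> x = 0 \<and> y = 0"
  using indep[of x "- y" 0] by simp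

lemma meet_opposite_edges: "meet (join A B) (join C D) = point_of (a - k *\<^sub>R b)"
proof (rule meet_eqI)
  show "subspace (join A B)" "subspace (join C D)"
    using represents_vertices by (simp_all add: join_eq_span)
  show "a - k *\<^sub>R b \<noteq> 0"
    using edge_combination_trivial[of 1 k] by auto
  show "join A B \<inter> join C D = span {a - k *\<^sub>R b}"
  proof (intro set_eqI iffI)
    fix v assume "v \<in> join A B \<inter> join C D"
    then have "v \<in> span {a, b}" "v \<in> span {c, d}"
      using represents_vertices by (auto simp: join_eq_span)
    then obtain x y z w where v: "v = x *\<^sub>R a + y *\<^sub>R b" "v = z *\<^sub>R c + w *\<^sub>R d"
      unfolding mem_span_pair by blast
    then have "x *\<^sub>R a + y *\<^sub>R b + 0 *\<^sub>R c = (w / k) *\<^sub>R a + (- w) *\<^sub>R b + (z + w / k) *\<^sub>R c"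
      by (simp add: d_eq algebra_simps)
    from coordinates_eq[OF this] have "v = x *\<^sub>R (a - k *\<^sub>R b)"
      using k_nonzero v(1) by (simp add: algebra_simps)
    then show "v \<in> span {a - k *\<^sub>R b}"
      by (simp add: span_base span_scale)
  next
    fix v assume "v \<in> span {a - k *\<^sub>R b}"
    then obtain x where v: "v = x *\<^sub>R (a - k *\<^sub>R b)"
      by (auto simp: span_singleton)
    have "v = x *\<^sub>R a + (- x * k) *\<^sub>R b"
      by (simp add: v algebra_simps)
    moreover have "v = (- x) *\<^sub>R c + (x * k) *\<^sub>R d"
      using k_nonzero by (simp add: v d_eq algebra_simps)
    ultimately have "v \<in> span {a, b} \<and> v \<in> span {c, d}"
      unfolding mem_span_pair by blast
    then show "v \<in> join A B \<inter> join C D"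
      using represents_vertices by (simp add: join_eq_span)
  qed
qed

definition double_line_support :: "'a set" where
  "double_line_support = join (meet (join A B) (join C D)) (meet (join B C) (join D A))"

text \<open>In the coordinates of the frame this line is the zero set of the functional with value \<open>k\<close> at
  \<open>a\<close> and \<open>c\<close> and 1 at \<open>b\<close>; this functional then also has the value 1 at \<open>d\<close>, so it takes the same
  value at \<open>a\<close>, \<open>k b\<close>, \<open>c\<close> and \<open>k d\<close>.\<close>

lemma mem_double_line_support_iff:
  "v \<in> double_line_support \<longleftrightarrow> (\<exists>x y z. v = x *\<^sub>R a + y *\<^sub>R b + z *\<^sub>R c \<and> k * x + y + k * z = 0)"
proof -
  interpret R: quad_frame B C D A b c d a "1 / k" by (rule rotate)
  have "a - k *\<^sub>R b \<noteq> 0" "b - (1 / k) *\<^sub>R c \<noteq> 0"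
    using edge_combination_trivial[of 1 k] R.edge_combination_trivial[of 1 "1 / k"] by auto
  then have "double_line_support = span {a - k *\<^sub>R b, b - (1 / k) *\<^sub>R c}"
    unfolding double_line_support_def meet_opposite_edges R.meet_opposite_edges
    by (simp add: join_eq_span represents_point_of)
  then have "v \<in> double_line_support \<longleftrightarrow>
      (\<exists>x y. v = x *\<^sub>R (a - k *\<^sub>R b) + y *\<^sub>R (b - (1 / k) *\<^sub>R c))"
    by (simp add: mem_span_pair)
  also have "\<dots> \<longleftrightarrow> (\<exists>x y z. v = x *\<^sub>R a + y *\<^sub>R b + z *\<^sub>R c \<and> k * x + y + k * z = 0)"
  proof safe
    fix x y
    show "\<exists>x' y' z'. x *\<^sub>R (a - k *\<^sub>R b) + y *\<^sub>R (b - (1 / k) *\<^sub>R c)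
        = x' *\<^sub>R a + y' *\<^sub>R b + z' *\<^sub>R c \<and> k * x' + y' + k * z' = 0"
      using k_nonzero
      by (intro exI[of _ x] exI[of _ "y - x * k"] exI[of _ "- y / k"]) (simp add: algebra_simps)
  next
    fix x y z assume "k * x + y + k * z = 0"
    then have y: "y = - k * x - k * z" by simp
    show "\<exists>x' y'. x *\<^sub>R a + y *\<^sub>R b + z *\<^sub>R c
        = x' *\<^sub>R (a - k *\<^sub>R b) + y' *\<^sub>R (b - (1 / k) *\<^sub>R c)"
      unfolding y using k_nonzero
      by (intro exI[of _ x] exI[of _ "- k * z"]) (simp add: algebra_simps)
  qed
  finally show ?thesis .
qed

subsection \<open>Adapted forms\<close>

text \<open>The diagonal relation determines the one value that the normal form leaves open on the basis
  \<open>a, b, c\<close>.  Hence an adapted form is unique on the plane.\<close>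

lemma adapted_polar_diagonal:
  assumes "adapted q a b c d"
  shows "polar q a c = 2 * k - 1"
proof -
  have q: "quadratic_form q"
    using assms by (simp add: adapted_def)
  have "polar q a (a + c) = k * (polar q a b + polar q a d)"
    unfolding diagonal_relation by (simp add: polar_linear[OF q])
  then show ?thesis
    using assms polar_self[OF q, of a] polar_commute[of q a d]
    by (simp add: polar_linear[OF q] adapted_def)
qed

lemma adapted_polar:
  assumes "adapted q a b c d"
  shows "polar q (x *\<^sub>R a + y *\<^sub>R b + z *\<^sub>R c) (x' *\<^sub>R a + y' *\<^sub>R b + z' *\<^sub>R c)
    = (x + y + z) * (x' + y' + z') + 2 * (k - 1) * (x * z' + z * x')"
proof -
  have q: "quadratic_form q"
    using assms by (simp add: adapted_def)
  have "polar q a a = 1" "polar q b b = 1" "polar q c c = 1" "polar q a b = 1" "polar q b a = 1"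
    "polar q b c = 1" "polar q c b = 1" "polar q a c = 2 * k - 1" "polar q c a = 2 * k - 1"
    using assms adapted_polar_diagonal[OF assms] polar_commute[of q] polar_self[OF q]
    by (simp_all add: adapted_def)
  then have "polar q (x *\<^sub>R a + y *\<^sub>R b + z *\<^sub>R c) (x' *\<^sub>R a + y' *\<^sub>R b + z' *\<^sub>R c)
    = x * (x' + y' + z' * (2 * k - 1)) + y * (x' + y' + z') + z * (x' * (2 * k - 1) + y' + z')"
    by (simp only: polar_linear[OF q]) (simp add: distrib_left)
  then show ?thesis
    by (simp add: algebra_simps)
qed

lemma adapted_apply:
  assumes "adapted q a b c d"
  shows "q (x *\<^sub>R a + y *\<^sub>R b + z *\<^sub>R c) = (x + y + z)\<^sup>2 + 4 * (k - 1) * x * z"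
  using adapted_polar[OF assms, of x y z x y z] assms
  by (simp add: polar_self adapted_def power2_eq_square)

lemma adapted_unique:
  assumes "adapted q a b c d" "adapted q' a b c d"
  shows "conic_of E q = conic_of E q'"
  by (rule conic_of_cong[of 1]) (auto simp: mem_E_iff adapted_apply[OF assms(1)] adapted_apply[OF assms(2)])

lemma ex_coordinate_functional:
  "\<exists>g. linear g \<and> g a = x \<and> g b = y \<and> g c = (z::real)"
proof -
  have "a \<notin> span {b, c}" "b \<notin> span {c}" "c \<noteq> 0"
  proof -
    show "a \<notin> span {b, c}"
    proof
      assume "a \<in> span {b, c}"
      then obtain y z where "a = y *\<^sub>R b + z *\<^sub>R c"
        by (auto simp: mem_span_pair)
      then show False
        using indep[of 1 "- y" "- z"] by simp
    qed
    show "b \<notin> span {c}"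
      using indep[of 0 "-1"] by (auto simp: span_singleton)
    show "c \<noteq> 0"
      using represents_vertices(3) by (simp add: represents_def)
  qed
  then have "independent {a, b, c}" and dist: "a \<noteq> b" "a \<noteq> c" "b \<noteq> c"
    by (auto simp: independent_insert span_base)
  from linear_independent_extend[OF this(1), of "\<lambda>v. if v = a then x else if v = b then y else z"]
  show ?thesis
    using dist by auto
qed

lemma ex_adapted: "\<exists>q. adapted q a b c d"
proof -
  obtain s where s: "linear s" "s a = 1" "s b = 1" "s c = (1::real)"
    using ex_coordinate_functional by blast
  obtain u where u: "linear u" "u a = 1" "u b = 0" "u c = (0::real)"
    using ex_coordinate_functional by blast
  obtain w where w: "linear w" "w a = 0" "w b = 0" "w c = (1::real)"
    using ex_coordinate_functional by blast
  (* The formula of adapted_apply, with functionals that extend the coordinates x + y + z, x, z. *)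
  define q where "q = (\<lambda>v. s v * s v + 4 * (k - 1) * (u v * w v))"
  have q: "quadratic_form q"
    unfolding q_def using s u w
    by (intro quadratic_form_add quadratic_form_cmult quadratic_form_mult)
  have polar_q: "polar q x y = s x * s y + 2 * (k - 1) * (u x * w y + u y * w x)" for x y
    by (simp add: polar_def q_def linear_add[OF s(1)] linear_add[OF u(1)] linear_add[OF w(1)]
        field_simps)
  have d: "s d = 2 / k - 1" "u d = 1 / k" "w d = 1 / k"
    using s u w by (simp_all add: d_eq linear_add linear_diff linear_cmul)
  have "adapted q a b c d"
    unfolding adapted_def using q s u w k_nonzero
    by (simp add: polar_q d) (simp add: q_def d field_simps)
  then show ?thesis
    by blast
qed

subsection \<open>An adapted form defines an inscribed conic\<close>

text \<open>The exceptional value \<open>k = 1\<close> is the one at which the adapted form degenerates to the square of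
  a linear functional, whose kernel is then the line that supports the inscribed double line.\<close>

lemma adapted_tangent_at:
  assumes "adapted q a b c d" "k \<noteq> 1"
  shows "tangent_at E (conic_of E q) (join A B) (point_of (a - b))"
    and "point_of (a - b) \<notin> {A, B, C, D}"
proof -
  have q: "quadratic_form q"
    using assms by (simp add: adapted_def)
  have nz: "a - b \<noteq> 0"
    using edge_combination_trivial[of 1 1] by auto
  have ab: "a - b = 1 *\<^sub>R a + (- 1) *\<^sub>R b + 0 *\<^sub>R c"
    by simp
  have "join A B = {y \<in> E. polar q (a - b) y = 0}"
  proof (intro set_eqI iffI)
    fix v assume "v \<in> join A B"
    then obtain x y where v: "v = x *\<^sub>R a + y *\<^sub>R b + 0 *\<^sub>R c"
      by (auto simp: mem_join_iff)
    have "polar q (a - b) v = 0"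
      unfolding ab v adapted_polar[OF assms(1)] by simp
    then show "v \<in> {y \<in> E. polar q (a - b) y = 0}"
      using v mem_E_iff by blast
  next
    fix v assume v: "v \<in> {y \<in> E. polar q (a - b) y = 0}"
    then obtain x y z where xyz: "v = x *\<^sub>R a + y *\<^sub>R b + z *\<^sub>R c"
      by (auto simp: mem_E_iff)
    with v have "z = 0"
      unfolding ab using adapted_polar[OF assms(1), of 1 "-1" 0 x y z] assms(2) by simp
    with xyz show "v \<in> join A B"
      by (auto simp: mem_join_iff)
  qed
  moreover have "q (a - b) = 0"
    unfolding ab adapted_apply[OF assms(1)] by simp
  moreover have "a - b \<in> E"
    using vertices_in_E subspace_E by (simp add: subspace_diff)
  ultimately show "tangent_at E (conic_of E q) (join A B) (point_of (a - b))"
    using tangent_at_conic_of_iff[OF q represents_point_of[OF nz] subspace_E] by simp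
  have "\<nexists>s. a - b = s *\<^sub>R v" if "v = x *\<^sub>R a + y *\<^sub>R b + z *\<^sub>R c" "x = 0 \<or> y = 0 \<or> z \<noteq> 0" for v x y z
  proof
    assume "\<exists>s. a - b = s *\<^sub>R v"
    then obtain s where "a - b = s *\<^sub>R v" ..
    then have "1 *\<^sub>R a + (- 1) *\<^sub>R b + 0 *\<^sub>R c = (s * x) *\<^sub>R a + (s * y) *\<^sub>R b + (s * z) *\<^sub>R c"
      unfolding ab[symmetric] that(1) by (simp add: algebra_simps)
    from coordinates_eq[OF this] that(2) show False by auto
  qed
  from this[of a 1 0 0] this[of b 0 1 0] this[of c 0 0 1] this[of d "1 / k" "- 1" "1 / k"]
  show "point_of (a - b) \<notin> {A, B, C, D}"
    using represents_vertices k_nonzero nz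
    by (auto simp: represents_iff d_eq[symmetric] eq_commute[of "point_of (a - b)"] point_of_eq_iff)
qed

lemma adapted_nondeg_inscribed:
  assumes "adapted q a b c d" "k \<noteq> 1"
  shows "nondeg_inscribed A B C D (conic_of E q)"
proof -
  have q: "quadratic_form q"
    using assms by (simp add: adapted_def)
  interpret R1: quad_frame B C D A b c d a "1 / k" by (rule rotate)
  interpret R2: quad_frame C D A B c d a b "1 / (1 / k)" by (rule R1.rotate)
  interpret R3: quad_frame D A B C d a b c "1 / (1 / (1 / k))" by (rule R2.rotate)
  have r: "R1.E = E" "R2.E = E" "R3.E = E"
    by (metis quad_plane_rotate)+
  have ad: "adapted q b c d a" "adapted q c d a b" "adapted q d a b c"
    using assms(1) by (simp_all add: adapted_def)
  have k: "1 / k \<noteq> 1" "1 / (1 / k) \<noteq> 1" "1 / (1 / (1 / k)) \<noteq> 1"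
    using assms(2) k_nonzero by auto
  have "x = 0" if xE: "x \<in> E" and radical: "\<forall>y\<in>E. polar q x y = 0" for x
  proof -
    obtain s t u where x: "x = s *\<^sub>R a + t *\<^sub>R b + u *\<^sub>R c"
      using xE[unfolded mem_E_iff] by blast
    have "polar q x a = 0" "polar q x b = 0" "polar q x c = 0"
      using radical vertices_in_E by auto
    then have "s + t + u + 2 * (k - 1) * u = 0" "s + t + u = 0" "s + t + u + 2 * (k - 1) * s = 0"
      using adapted_polar[OF assms(1), of s t u 1 0 0] adapted_polar[OF assms(1), of s t u 0 1 0]
        adapted_polar[OF assms(1), of s t u 0 0 1] by (simp_all add: x)
    with assms(2) have "s = 0" "t = 0" "u = 0" by auto
    with x show ?thesis by simp
  qed
  then have "nondegenerate_conic E (conic_of E q)"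
    using nondegenerate_conic_of_iff[OF q subspace_E E_nonzero] by blast
  then show ?thesis
    unfolding nondeg_inscribed_def edge_lines_def
    using adapted_tangent_at[OF assms] R1.adapted_tangent_at[OF ad(1) k(1)]
      R2.adapted_tangent_at[OF ad(2) k(2)] R3.adapted_tangent_at[OF ad(3) k(3)]
    unfolding r by auto
qed

lemma adapted_deg_inscribed:
  assumes "adapted q a b c d" "k = 1"
  shows "deg_inscribed A B C D (conic_of E q)"
  unfolding deg_inscribed_def double_line_def double_line_support_def[symmetric]
proof (intro exI conjI)
  have q: "quadratic_form q"
    using assms by (simp add: adapted_def)
  (* On the plane, the polar of b is the sum of coordinates, of which q is the square. *)
  have polar_b: "polar q b (x *\<^sub>R a + y *\<^sub>R b + z *\<^sub>R c) = x + y + z" for x y z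
    using adapted_polar[OF assms(1), of 0 1 0 x y z] by simp
  show "linear (polar q b)"
    by (rule linearI) (simp_all add: polar_linear[OF q])
  show "double_line_support = {x \<in> E. polar q b x = 0}"
  proof (intro set_eqI)
    fix v
    have "v \<in> {x \<in> E. polar q b x = 0} \<longleftrightarrow>
        (\<exists>x y z. v = x *\<^sub>R a + y *\<^sub>R b + z *\<^sub>R c \<and> polar q b (x *\<^sub>R a + y *\<^sub>R b + z *\<^sub>R c) = 0)"
      unfolding mem_Collect_eq mem_E_iff by blast
    then show "v \<in> double_line_support \<longleftrightarrow> v \<in> {x \<in> E. polar q b x = 0}"
      unfolding mem_double_line_support_iff polar_b using assms(2) by simp
  qed
  show "conic_of E q = conic_of E (\<lambda>x. (polar q b x)\<^sup>2)"
    by (rule conic_of_cong[of 1]) (auto simp: mem_E_iff polar_b adapted_apply[OF assms(1)] assms(2))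
qed

lemma adapted_inscribed:
  assumes "adapted q a b c d"
  shows "inscribed A B C D (conic_of E q)"
  using adapted_nondeg_inscribed[OF assms] adapted_deg_inscribed[OF assms]
  unfolding inscribed_def by blast

lemma adapted_tangency_point_iff:
  assumes "adapted q a b c d"
  shows "tangency_point A B C D (conic_of E q) (join A B) p \<longleftrightarrow> p = point_of (a - b)"
proof
  have q: "quadratic_form q"
    using assms by (simp add: adapted_def)
  have nz: "a - b \<noteq> 0"
    using edge_combination_trivial[of 1 1] by auto
  have sub: "subspace (join A B)"
    using represents_vertices by (simp add: join_eq_span)
  have joinE: "v \<in> E" if "v \<in> join A B" for v
    using that vertices_in_E subspace_E by (auto simp: mem_join_iff subspace_add subspace_scale)
  {
    assume t: "tangency_point A B C D (conic_of E q) (join A B) p"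
    obtain v where v: "represents v p"
      using ex_represents by blast
    have "v \<in> join A B \<and> q v = 0"
      using t unfolding tangency_point_def
    proof (elim conjE disjE)
      assume "tangent_at E (conic_of E q) (join A B) p"
      then show ?thesis
        using tangent_at_conic_of_iff[OF q v subspace_E] polar_self[OF q] by auto
    next
      assume "p on join A B" "on_conic p (conic_of E q)"
      then show ?thesis
        using on_subspace_iff[OF v sub] on_conic_of_iff[OF q v joinE subspace_E] by auto
    qed
    then obtain x y where xy: "v = x *\<^sub>R a + y *\<^sub>R b" "q v = 0"
      by (auto simp: mem_join_iff)
    then have "y = - x"
      using adapted_apply[OF assms, of x y 0] by simp
    then have "v = x *\<^sub>R (a - b)"
      using xy by (simp add: algebra_simps)
    then show "p = point_of (a - b)"
      using v nz by (metis point_of_eq_iff represents_iff)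
  }
  {
    assume p: "p = point_of (a - b)"
    have rep: "represents (a - b) p"
      unfolding p by (rule represents_point_of[OF nz])
    have mem: "a - b \<in> join A B"
      unfolding mem_join_iff by (intro exI[of _ 1] exI[of _ "-1"]) simp
    have "q (a - b) = 0"
      using adapted_apply[OF assms, of 1 "-1" 0] by simp
    then have "on_conic p (conic_of E q)" "p on join A B"
      using on_conic_of_iff[OF q rep joinE[OF mem] subspace_E] on_subspace_iff[OF rep sub] mem
      by auto
    then show "tangency_point A B C D (conic_of E q) (join A B) p"
      unfolding tangency_point_def edge_lines_def
      using adapted_nondeg_inscribed[OF assms] adapted_tangent_at(1)[OF assms]
        adapted_deg_inscribed[OF assms] p by auto
  }
qed

end

context quad_frame
begin

subsection \<open>Every inscribed conic comes from an adapted form\<close>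

text \<open>If \<open>a - s b\<close> represents the tangency point, its polar vanishes at both vertices.  The two equations
  say that \<open>q\<close> takes the same value at \<open>a\<close> and at \<open>s b\<close>, and that this is also the polar value of
  these two vectors, so \<open>s b\<close> is the right rescaling of \<open>b\<close>.\<close>

lemma tangency_ratio:
  assumes q: "quadratic_form q"
    and tangent: "tangent_at E (conic_of E q) (join A B) p" "p \<notin> {A, B, C, D}"
  shows "\<exists>s. s \<noteq> 0 \<and> q a = s * polar q a b \<and> polar q a b = s * q b"
proof -
  obtain v where v: "represents v p"
    using ex_represents by blast
  from tangent(1) have "v \<in> E" "q v = 0" and L: "join A B = {y \<in> E. polar q v y = 0}"
    unfolding tangent_at_conic_of_iff[OF q v subspace_E] by auto
  then have "v \<in> join A B"
    using polar_self[OF q] by simp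
  then obtain x y where xy: "v = x *\<^sub>R a + y *\<^sub>R b"
    unfolding mem_join_iff by blast
  have "v \<noteq> 0" and p: "p = point_of v"
    using v by (auto simp: represents_iff)
  have "x \<noteq> 0"
  proof
    assume "x = 0"
    then have "p = B"
      using p \<open>v \<noteq> 0\<close> xy represents_vertices(2) point_of_eq_iff[of b v] by (auto simp: represents_iff)
    with tangent(2) show False by simp
  qed
  have "y \<noteq> 0"
  proof
    assume "y = 0"
    then have "p = A"
      using p \<open>v \<noteq> 0\<close> xy represents_vertices(1) point_of_eq_iff[of a v] by (auto simp: represents_iff)
    with tangent(2) show False by simp
  qed
  have "a \<in> join A B" "b \<in> join A B"
    using represents_vertices by (auto simp: join_eq_span span_base)
  then have "polar q v a = 0" "polar q v b = 0"
    using L by auto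
  then have "x * q a + y * polar q a b = 0" "x * polar q a b + y * q b = 0"
    by (simp_all add: xy polar_linear[OF q] polar_self[OF q] polar_commute[of q b a])
  with \<open>x \<noteq> 0\<close> \<open>y \<noteq> 0\<close> show ?thesis
    by (intro exI[of _ "- y / x"]) (simp add: field_simps)
qed

lemma radical_trivial:
  assumes q: "quadratic_form q" and "nondegenerate_conic E (conic_of E q)"
    and x: "x \<in> E" and "polar q x a = 0" "polar q x b = 0" "polar q x c = 0"
  shows "x = 0"
proof -
  have "polar q x y = 0" if "y \<in> E" for y
    using that assms(4-6) by (auto simp: mem_E_iff polar_linear[OF q])
  then show ?thesis
    using assms(2) x nondegenerate_conic_of_iff[OF q subspace_E E_nonzero] by blast
qed

end

text \<open>Rescaling along the edges from \<open>a\<close> leads to \<open>(1/U) b\<close>, \<open>(1/V) c\<close>, \<open>(1/W) d\<close>, and \<open>e\<close> is the polar value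
  of the last vector and \<open>a\<close>; it can differ from 1 by its sign only.  The value \<open>m\<close> is that of the
  polar form at \<open>a\<close> and \<open>c\<close>, and \<open>m = V\<close> would place \<open>V a - c\<close> in the radical.  The equations express
  that the polar form respects the relation \<open>a + c = k (b + d)\<close>; two of them remain after the
  elimination of \<open>m\<close>.  For \<open>e = 1\<close> both factor with the
  common factor \<open>1 + V - k (U + W)\<close>, which non-degeneracy excludes.  For \<open>e = -1\<close>, with one of
  them multiplied by \<open>k\<close>, their sum and their difference are products of two linear factors each,
  and any choice of a vanishing factor in both products forces one of the
  coefficients \<open>1, V, k U, k W\<close> of the rescaled relation to vanish.\<close>

lemma tangency_signs_and_scales:
  fixes U V W k e m :: real
  assumes nonzero: "U \<noteq> 0" "V \<noteq> 0" "W \<noteq> 0" "k \<noteq> 0" and e: "e\<^sup>2 = 1"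
    and a: "1 + m = k * (U + e * W)" and c: "m + V\<^sup>2 = k * (U * V + V * W)"
    and bd: "U + U * V - e * W - V * W = k * (U\<^sup>2 - W\<^sup>2)"
    and nondegenerate: "m \<noteq> V"
  shows "e = 1 \<and> V = 1 \<and> U = W"
proof -
  have ac: "1 - V\<^sup>2 = k * (U + e * W - U * V - V * W)"
    using a c by (simp add: algebra_simps)
  have "e = 1 \<or> e = - 1"
    using e by (simp add: power2_eq_1_iff)
  then show ?thesis
  proof
    assume e1: "e = 1"
    have "1 + V \<noteq> k * (U + W)"
      using a nondegenerate e1 by auto
    moreover have "(1 - V) * (1 + V - k * (U + W)) = 0" "(U - W) * (1 + V - k * (U + W)) = 0"
      using ac bd e1 by (simp_all add: algebra_simps power2_eq_square)
    ultimately show ?thesis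
      using e1 by simp
  next
    assume e2: "e = - 1"
    have "(1 + V - k * U - k * W) * (1 - V - k * U + k * W) =
        (1 - V\<^sup>2 - k * (U - W - U * V - V * W)) - k * (U + U * V + W - V * W - k * (U\<^sup>2 - W\<^sup>2))"
      "(1 + V - k * U + k * W) * (1 - V + k * U + k * W) =
        (1 - V\<^sup>2 - k * (U - W - U * V - V * W)) + k * (U + U * V + W - V * W - k * (U\<^sup>2 - W\<^sup>2))"
      by (simp_all add: algebra_simps power2_eq_square)
    then have "(1 + V - k * U - k * W) * (1 - V - k * U + k * W) = 0"
      "(1 + V - k * U + k * W) * (1 - V + k * U + k * W) = 0"
      using ac bd e2 by simp_all
    moreover have "k * U \<noteq> 0" "k * W \<noteq> 0"
      using nonzero by simp_all
    moreover have False if "P \<noteq> 0" "Q \<noteq> 0" "(1 + V - P - Q) * (1 - V - P + Q) = 0"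
        "(1 + V - P + Q) * (1 - V + P + Q) = 0" for P Q :: real
      using that nonzero(2) by auto
    ultimately show ?thesis
      by blast
  qed
qed

context quad_frame
begin

text \<open>Transporting the rescaling of \<open>tangency_ratio\<close> once around the quadrilateral brings the form into
  the situation of \<open>tangency_signs_and_scales\<close>, which then identifies it as adapted.\<close>

lemma nondeg_inscribed_imp_adapted:
  assumes "nondeg_inscribed A B C D \<C>"
  shows "\<exists>r q. r \<noteq> 0 \<and> adapted q a (r *\<^sub>R b) c (r *\<^sub>R d) \<and> \<C> = conic_of E q"
proof -
  interpret R1: quad_frame B C D A b c d a "1 / k" by (rule rotate)
  interpret R2: quad_frame C D A B c d a b "1 / (1 / k)" by (rule R1.rotate)
  interpret R3: quad_frame D A B C d a b c "1 / (1 / (1 / k))" by (rule R2.rotate)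
  have rot: "R1.E = E" "R2.E = E" "R3.E = E"
    by (metis quad_plane_rotate)+
  from assms obtain q where q: "quadratic_form q" and C: "\<C> = conic_of E q"
    by (auto simp: nondeg_inscribed_def nondegenerate_conic_def conic_in_def)
  have nondeg: "nondegenerate_conic E (conic_of E q)"
    and tangent: "\<And>L. L \<in> {join A B, join B C, join C D, join D A} \<Longrightarrow>
      \<exists>p. tangent_at E (conic_of E q) L p \<and> p \<notin> {A, B, C, D}"
    using assms unfolding nondeg_inscribed_def edge_lines_def C by auto
  obtain p1 where p1: "tangent_at E (conic_of E q) (join A B) p1" "p1 \<notin> {A, B, C, D}"
    using tangent[of "join A B"] by blast
  obtain s1 where s1: "s1 \<noteq> 0" "q a = s1 * polar q a b" "polar q a b = s1 * q b"
    using tangency_ratio[OF q p1] by blast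
  obtain p2 where p2: "tangent_at E (conic_of E q) (join B C) p2" "p2 \<notin> {A, B, C, D}"
    using tangent[of "join B C"] by blast
  obtain s2 where s2: "s2 \<noteq> 0" "q b = s2 * polar q b c" "polar q b c = s2 * q c"
    using R1.tangency_ratio[OF q, unfolded rot, OF p2(1)] p2(2) by blast
  obtain p3 where p3: "tangent_at E (conic_of E q) (join C D) p3" "p3 \<notin> {A, B, C, D}"
    using tangent[of "join C D"] by blast
  obtain s3 where s3: "s3 \<noteq> 0" "q c = s3 * polar q c d" "polar q c d = s3 * q d"
    using R2.tangency_ratio[OF q, unfolded rot, OF p3(1)] p3(2) by blast
  obtain p4 where p4: "tangent_at E (conic_of E q) (join D A) p4" "p4 \<notin> {A, B, C, D}"
    using tangent[of "join D A"] by blast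
  obtain s4 where s4: "s4 \<noteq> 0" "q d = s4 * polar q d a" "polar q d a = s4 * q a"
    using R3.tangency_ratio[OF q, unfolded rot, OF p4(1)] p4(2) by blast
  have polar_diag: "polar q x a + polar q x c = k * (polar q x b + polar q x d)" for x
  proof -
    have "polar q x (a + c) = polar q x (k *\<^sub>R (b + d))"
      by (simp only: diagonal_relation)
    then show ?thesis
      by (simp add: polar_linear[OF q])
  qed
  (* Otherwise a is conjugate to itself and to both neighbours, so it lies in the radical. *)
  have "q a \<noteq> 0"
  proof
    assume "q a = 0"
    then have "polar q a a = 0" "polar q a b = 0" "polar q a d = 0"
      using s1 s4 by (auto simp: polar_self[OF q] polar_commute[of q a d])
    with polar_diag[of a] have "a = 0"
      by (intro radical_trivial[OF q nondeg vertices_in_E(1)]) auto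
    then show False
      using represents_vertices(1) by (simp add: represents_def)
  qed
  (* Reciprocals of the accumulated scales of b, c, d; dividing by t = q a normalises the form. *)
  define t where "t = q a"
  define U where "U = 1 / s1"
  define V where "V = 1 / (s1 * s2)"
  define W where "W = 1 / (s1 * s2 * s3)"
  define e where "e = s1 * s2 * s3 * s4"
  define m where "m = polar q a c / t"
  have t: "t \<noteq> 0"
    using \<open>q a \<noteq> 0\<close> by (simp add: t_def)
  have nz: "U \<noteq> 0" "V \<noteq> 0" "W \<noteq> 0"
    using s1(1) s2(1) s3(1) by (simp_all add: U_def V_def W_def)
  have vals: "q a = t" "polar q a b = t * U" "q b = t * U\<^sup>2" "polar q b c = t * (U * V)"
    "q c = t * V\<^sup>2" "polar q c d = t * (V * W)" "q d = t * W\<^sup>2"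
    using s1 s2 s3 by (simp_all add: t_def U_def V_def W_def power2_eq_square field_simps)
  have da: "polar q d a = t * (e * W)" and "q d = t * (e\<^sup>2 * W\<^sup>2)"
    using s1(1) s2(1) s3(1) s4 by (simp_all add: t_def W_def e_def power2_eq_square)
  with vals(7) have e: "e\<^sup>2 = 1"
    using t nz by simp
  have ac: "polar q a c = t * m"
    using t by (simp add: m_def)
  have eqs: "1 + m = k * (U + e * W)" "m + V\<^sup>2 = k * (U * V + V * W)"
    "U + U * V - e * W - V * W = k * (U\<^sup>2 - W\<^sup>2)"
  proof -
    have "t * (1 + m) = t * (k * (U + e * W))"
      using polar_diag[of a] by (simp add: polar_self[OF q] vals da ac polar_commute[of q a d] algebra_simps)
    then show "1 + m = k * (U + e * W)"
      using t by simp
    have "t * (m + V\<^sup>2) = t * (k * (U * V + V * W))"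
      using polar_diag[of c]
      by (simp add: polar_self[OF q] vals ac polar_commute[of q c a] polar_commute[of q c b] algebra_simps)
    then show "m + V\<^sup>2 = k * (U * V + V * W)"
      using t by simp
    have "t * (U + U * V - e * W - V * W) = t * (k * (U\<^sup>2 - W\<^sup>2))"
      using polar_diag[of b] polar_diag[of d]
      by (simp add: polar_self[OF q] vals da polar_commute[of q b a] polar_commute[of q d c]
          polar_commute[of q d b] algebra_simps)
    then show "U + U * V - e * W - V * W = k * (U\<^sup>2 - W\<^sup>2)"
      using t by simp
  qed
  have "m \<noteq> V"
  proof
    assume "m = V"
    then have "polar q (V *\<^sub>R a - c) a = 0" "polar q (V *\<^sub>R a - c) b = 0" "polar q (V *\<^sub>R a - c) c = 0"
      using vals ac
      by (simp_all add: polar_linear[OF q] polar_self[OF q] polar_commute[of q c] power2_eq_square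
          algebra_simps)
    moreover have "V *\<^sub>R a - c \<in> E"
      using vertices_in_E subspace_E by (simp add: subspace_diff subspace_scale)
    ultimately have "V *\<^sub>R a - c = 0"
      using radical_trivial[OF q nondeg] by blast
    then show False
      using indep[of V 0 "- 1"] by simp
  qed
  with tangency_signs_and_scales[OF nz k_nonzero e eqs]
  have scales: "e = 1" "V = 1" "W = U" by auto
  define r where "r = 1 / U"
  have r: "r \<noteq> 0" "U * r = 1"
    using nz by (simp_all add: r_def)
  have qt: "quadratic_form (\<lambda>x. (1 / t) * q x)"
    by (rule quadratic_form_cmult[OF q])
  have "adapted (\<lambda>x. (1 / t) * q x) a (r *\<^sub>R b) c (r *\<^sub>R d)"
    unfolding adapted_def polar_cmult polar_linear[OF q] quadratic_form_scale[OF q] vals da scales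
    using qt t r nz by (simp add: r_def power_divide)
  moreover have "\<C> = conic_of E (\<lambda>x. (1 / t) * q x)"
    unfolding C by (rule conic_of_cong[of t]) (use t in auto)
  ultimately show ?thesis
    using r(1) by blast
qed

text \<open>By \<open>mem_double_line_support_iff\<close> a functional that vanishes on the line through the intersections of
  opposite edges takes the same value at \<open>a\<close>, \<open>k b\<close>, \<open>c\<close>, \<open>k d\<close>, so up to a factor its square is
  adapted with \<open>r = k\<close>.\<close>

lemma deg_inscribed_imp_adapted:
  assumes "deg_inscribed A B C D \<C>"
  shows "\<exists>r q. r \<noteq> 0 \<and> adapted q a (r *\<^sub>R b) c (r *\<^sub>R d) \<and> \<C> = conic_of E q"
proof -
  from assms obtain g where g: "linear g" and L: "double_line_support = {x \<in> E. g x = 0}"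
    and C: "\<C> = conic_of E (\<lambda>x. (g x)\<^sup>2)"
    unfolding deg_inscribed_def double_line_def double_line_support_def[symmetric] by blast
  have coords: "g (x *\<^sub>R a + y *\<^sub>R b + z *\<^sub>R c) = 0 \<longleftrightarrow> k * x + y + k * z = 0" for x y z
  proof -
    let ?v = "x *\<^sub>R a + y *\<^sub>R b + z *\<^sub>R c"
    have "?v \<in> double_line_support \<longleftrightarrow> k * x + y + k * z = 0"
      unfolding mem_double_line_support_iff using coordinates_eq by metis
    moreover have "?v \<in> E"
      using mem_E_iff by blast
    ultimately show ?thesis
      using L by simp
  qed
  have "g a \<noteq> 0"
    using coords[of 1 0 0] k_nonzero by simp
  have b: "k * g b = g a"
    using coords[of 1 "- k" 0] by (simp add: linear_diff[OF g] linear_cmul[OF g])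
  have c: "g c = g a"
    using coords[of 1 0 "- 1"] by (simp add: linear_diff[OF g])
  have d: "k * g d = g a"
  proof -
    have "g (a + c) = k * (g b + g d)"
      by (simp add: diagonal_relation linear_add[OF g] linear_cmul[OF g])
    then show ?thesis
      using b c by (simp add: linear_add[OF g] algebra_simps)
  qed
  define t where "t = (g a)\<^sup>2"
  have t: "t \<noteq> 0"
    using \<open>g a \<noteq> 0\<close> by (simp add: t_def)
  define q where "q = (\<lambda>x. (1 / t) * (g x * g x))"
  have q: "quadratic_form q"
    unfolding q_def by (intro quadratic_form_cmult quadratic_form_mult g)
  have polar_q: "polar q x y = g x * g y / t" for x y
    unfolding q_def polar_cmult by (simp add: polar_def linear_add[OF g] algebra_simps)
  have "adapted q a (k *\<^sub>R b) c (k *\<^sub>R d)"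
    unfolding adapted_def polar_q
    using q t by (simp add: q_def linear_cmul[OF g] b c d t_def power2_eq_square)
  moreover have "\<C> = conic_of E q"
    unfolding C by (rule conic_of_cong[of t]) (use t in \<open>auto simp: q_def power2_eq_square\<close>)
  ultimately show ?thesis
    using k_nonzero by blast
qed

subsection \<open>The one-parameter family of inscribed conics\<close>

text \<open>All adapted forms of the rescaled frame agree on the plane, so the choice does not affect the
  conic.\<close>

definition ratio_conic :: "real \<Rightarrow> 'a conic" where
  "ratio_conic r = conic_of E (SOME q. adapted q a (r *\<^sub>R b) c (r *\<^sub>R d))"

lemma ratio_conic_eq:
  assumes "r \<noteq> 0" "adapted q a (r *\<^sub>R b) c (r *\<^sub>R d)"
  shows "ratio_conic r = conic_of E q"
proof -
  interpret S: quad_frame A B C D a "r *\<^sub>R b" c "r *\<^sub>R d" "k / r"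
    by (rule rescale[OF assms(1)])
  show ?thesis
    unfolding ratio_conic_def
    by (rule S.adapted_unique[OF _ assms(2)]) (rule someI[of "\<lambda>q. adapted q _ _ _ _", OF assms(2)])
qed

lemma inscribed_iff_ratio_conic: "inscribed A B C D \<C> \<longleftrightarrow> (\<exists>r. r \<noteq> 0 \<and> \<C> = ratio_conic r)"
proof
  assume "inscribed A B C D \<C>"
  then show "\<exists>r. r \<noteq> 0 \<and> \<C> = ratio_conic r"
    unfolding inscribed_def
    using nondeg_inscribed_imp_adapted deg_inscribed_imp_adapted ratio_conic_eq by metis
next
  assume "\<exists>r. r \<noteq> 0 \<and> \<C> = ratio_conic r"
  then obtain r where r: "r \<noteq> 0" "\<C> = ratio_conic r" by blast
  interpret S: quad_frame A B C D a "r *\<^sub>R b" c "r *\<^sub>R d" "k / r"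
    by (rule rescale[OF r(1)])
  obtain q where q: "adapted q a (r *\<^sub>R b) c (r *\<^sub>R d)"
    using S.ex_adapted by blast
  show "inscribed A B C D \<C>"
    using S.adapted_inscribed[OF q] r ratio_conic_eq[OF r(1) q] by simp
qed

lemma ratio_conic_tangency_points:
  assumes r: "r \<noteq> 0"
  shows "tangency_point A B C D (ratio_conic r) (join A B) p \<longleftrightarrow> p = point_of (a - r *\<^sub>R b)"
    and "tangency_point A B C D (ratio_conic r) (join A D) p \<longleftrightarrow> p = point_of (a - r *\<^sub>R d)"
    and "tangency_point A B C D (ratio_conic r) (join B C) p \<longleftrightarrow> p = point_of (b - (1 / r) *\<^sub>R c)"
    and "tangency_point A B C D (ratio_conic r) (join D C) p \<longleftrightarrow> p = point_of (d - (1 / r) *\<^sub>R c)"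
proof -
  interpret S: quad_frame A B C D a "r *\<^sub>R b" c "r *\<^sub>R d" "k / r"
    by (rule rescale[OF r])
  interpret R1: quad_frame B C D A "r *\<^sub>R b" c "r *\<^sub>R d" a "1 / (k / r)" by (rule S.rotate)
  interpret R2: quad_frame C D A B c "r *\<^sub>R d" a "r *\<^sub>R b" "1 / (1 / (k / r))" by (rule R1.rotate)
  interpret R3: quad_frame D A B C "r *\<^sub>R d" a "r *\<^sub>R b" c "1 / (1 / (1 / (k / r)))" by (rule R2.rotate)
  have rot: "R1.E = E" "R2.E = E" "R3.E = E"
    by (metis quad_plane_rotate)+
  obtain q where q: "adapted q a (r *\<^sub>R b) c (r *\<^sub>R d)"
    using S.ex_adapted by blast
  have ad: "adapted q (r *\<^sub>R b) c (r *\<^sub>R d) a" "adapted q c (r *\<^sub>R d) a (r *\<^sub>R b)"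
    "adapted q (r *\<^sub>R d) a (r *\<^sub>R b) c"
    using q by (simp_all add: adapted_def)
  note C = ratio_conic_eq[OF r q]
  have proportional: "point_of v = point_of w" if "v = s *\<^sub>R w" "v \<noteq> 0" for v w :: 'a and s
    using that point_of_eq_iff[of w v] by auto
  show "tangency_point A B C D (ratio_conic r) (join A B) p \<longleftrightarrow> p = point_of (a - r *\<^sub>R b)"
    unfolding C by (rule S.adapted_tangency_point_iff[OF q])
  have "tangency_point A B C D (ratio_conic r) (join D A) p \<longleftrightarrow> p = point_of (r *\<^sub>R d - a)"
    unfolding C using R3.adapted_tangency_point_iff[OF ad(3), of p] unfolding rot
    by (metis tangency_point_rotate)
  moreover have "point_of (r *\<^sub>R d - a) = point_of (a - r *\<^sub>R d)"
    using R3.edge_combination_trivial[of 1 1] by (intro proportional[of _ "-1"]) auto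
  ultimately show "tangency_point A B C D (ratio_conic r) (join A D) p \<longleftrightarrow> p = point_of (a - r *\<^sub>R d)"
    by (simp add: join_commute)
  have "tangency_point A B C D (ratio_conic r) (join B C) p \<longleftrightarrow> p = point_of (r *\<^sub>R b - c)"
    unfolding C using R1.adapted_tangency_point_iff[OF ad(1), of p] unfolding rot
    by (metis tangency_point_rotate)
  moreover have "point_of (r *\<^sub>R b - c) = point_of (b - (1 / r) *\<^sub>R c)"
    using R1.edge_combination_trivial[of 1 1] r
    by (intro proportional[of _ r]) (auto simp: algebra_simps)
  ultimately show "tangency_point A B C D (ratio_conic r) (join B C) p \<longleftrightarrow> p = point_of (b - (1 / r) *\<^sub>R c)"
    by simp
  have "tangency_point A B C D (ratio_conic r) (join C D) p \<longleftrightarrow> p = point_of (c - r *\<^sub>R d)"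
    unfolding C using R2.adapted_tangency_point_iff[OF ad(2), of p] unfolding rot
    by (metis tangency_point_rotate)
  moreover have "point_of (c - r *\<^sub>R d) = point_of (d - (1 / r) *\<^sub>R c)"
    using R2.edge_combination_trivial[of 1 1] r
    by (intro proportional[of _ "- r"]) (auto simp: algebra_simps)
  ultimately show "tangency_point A B C D (ratio_conic r) (join D C) p \<longleftrightarrow> p = point_of (d - (1 / r) *\<^sub>R c)"
    by (simp add: join_commute)
qed

end

text \<open>Genericity of the edge-lines enters here: adjacent edge-lines are distinct, so no three of the
  vertices are collinear, and therefore in the linear relation of the four vectors no coefficient
  vanishes.  This is what permits the scaling of a frame.\<close>

lemma planar_quad_frame:
  assumes planar: "planar_quad A B C D"
    and rep: "represents a A" "represents b B" "represents c C" "represents d D"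
  shows "\<exists>s t k. s \<noteq> 0 \<and> t \<noteq> 0 \<and> quad_frame A B C D a b (s *\<^sub>R c) (t *\<^sub>R d) k"
proof -
  obtain P where P: "subspace P" "dim P = 3" "A on P" "B on P" "C on P" "D on P"
    using planar by (auto simp: planar_quad_def proj_plane_def)
  have mem: "a \<in> P" "b \<in> P" "c \<in> P" "d \<in> P"
    using P(3-6) on_subspace_iff[OF _ P(1)] rep by blast+
  have lines: "dim (join A B) = 2" "dim (join B C) = 2" "dim (join C D) = 2" "dim (join D A) = 2"
    and distinct: "join A B \<noteq> join B C" "join A B \<noteq> join D A" "join B C \<noteq> join C D"
      "join C D \<noteq> join D A"
    using planar by (auto simp: planar_quad_def generic_lines_def edge_lines_def proj_line_def)
  have joins: "join A B = span {a, b}" "join B C = span {b, c}" "join C D = span {c, d}"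
    "join D A = span {d, a}"
    using rep by (simp_all add: join_eq_span)
  have line_eqI: "span {x, y} = span {z, w}"
    if "dim (span {x, y}) = 2" "dim (span {z, w}) = 2" "z \<in> span {x, y}" "w \<in> span {x, y}"
    for x y z w :: 'a
  proof (rule sym, rule subspace_dim_equal)
    show "span {z, w} \<subseteq> span {x, y}"
      using that by (intro span_minimal) auto
  qed (use that in auto)
  have gen: "x \<in> span {x, y}" "y \<in> span {x, y}" for x y :: 'a
    by (simp_all add: span_base)
  have c: "c \<notin> span {a, b}"
    using line_eqI[of a b b c] gen lines distinct(1) unfolding joins by blast
  have b: "b \<notin> span {a}"
  proof
    assume "b \<in> span {a}"
    then have "span {a, b} = span {a}"
      using span_redundant[of b "{a}"] by (simp add: insert_commute)
    then have "dim (span {a, b}) = dim {a}"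
      by simp
    moreover have "dim {a} \<le> 1"
      by (simp add: dim_singleton)
    ultimately show False
      using lines(1) unfolding joins by simp
  qed
  have a: "a \<noteq> 0"
    using rep by (simp add: represents_def)
  have indep: "x = 0 \<and> y = 0 \<and> z = 0" if zero: "x *\<^sub>R a + y *\<^sub>R b + z *\<^sub>R c = 0" for x y z
  proof -
    have "z = 0"
    proof (rule ccontr)
      assume z: "z \<noteq> 0"
      have "z *\<^sub>R c = (- x) *\<^sub>R a + (- y) *\<^sub>R b"
        using zero by (simp add: eq_neg_iff_add_eq_0 algebra_simps)
      then have "(1 / z) *\<^sub>R (z *\<^sub>R c) = (- x / z) *\<^sub>R a + (- y / z) *\<^sub>R b"
        by (simp add: scaleR_diff_right)
      then have "c = (- x / z) *\<^sub>R a + (- y / z) *\<^sub>R b"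
        using z by simp
      with c show False
        unfolding mem_span_pair by blast
    qed
    moreover have "y = 0"
    proof (rule ccontr)
      assume y: "y \<noteq> 0"
      have "y *\<^sub>R b = (- x) *\<^sub>R a"
        using zero \<open>z = 0\<close> by (simp add: eq_neg_iff_add_eq_0 algebra_simps)
      then have "(1 / y) *\<^sub>R (y *\<^sub>R b) = (- x / y) *\<^sub>R a"
        by simp
      then have "b = (- x / y) *\<^sub>R a"
        using y by simp
      with b show False
        unfolding span_singleton by blast
    qed
    ultimately show ?thesis
      using zero a by simp
  qed
  have "independent {a, b, c}"
  proof -
    have "independent (insert b {a})"
      by (rule independent_insertI[OF b]) (use a in simp)
    then have "independent (insert c {a, b})"
      by (intro independent_insertI[OF c]) (simp add: insert_commute)
    then show ?thesis
      by (simp add: insert_commute)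
  qed
  moreover have "a \<noteq> b" "a \<noteq> c" "b \<noteq> c"
    using b c by (auto simp: span_base)
  then have "card {a, b, c} = 3"
    by simp
  ultimately have "dim (span {a, b, c}) = 3"
    by (simp add: dim_eq_card_independent)
  then have "span {a, b, c} = P"
    using P(1,2) mem by (intro subspace_dim_equal) (auto intro: span_minimal subspace_span simp: span_minimal)
  with mem(4) obtain x y z where d: "d = x *\<^sub>R a + y *\<^sub>R b + z *\<^sub>R c"
    using mem_span_triple by blast
  have "z \<noteq> 0"
  proof
    assume "z = 0"
    then have "d \<in> span {a, b}"
      using d by (auto simp: mem_span_pair)
    then show False
      using line_eqI[of a b d a] gen lines distinct(2) unfolding joins by blast
  qed
  have "x \<noteq> 0"
  proof
    assume "x = 0"
    then have "d \<in> span {b, c}"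
      using d by (auto simp: mem_span_pair)
    then show False
      using line_eqI[of b c c d] gen lines distinct(3) unfolding joins by blast
  qed
  have "y \<noteq> 0"
  proof
    assume "y = 0"
    then have "(1 / x) *\<^sub>R d = a + (z / x) *\<^sub>R c"
      using d \<open>x \<noteq> 0\<close> by (simp add: algebra_simps)
    then have "a = (- z / x) *\<^sub>R c + (1 / x) *\<^sub>R d"
      by simp
    then have "a \<in> span {c, d}"
      unfolding mem_span_pair by blast
    then show False
      using line_eqI[of c d d a] gen lines distinct(4) unfolding joins by blast
  qed
  (* Divide d = x a + y b + z c by x and move the terms of b and d to one side. *)
  have "quad_frame A B C D a b ((z / x) *\<^sub>R c) ((- 1 / y) *\<^sub>R d) (- y / x)"
  proof
    fix u v w :: real
    assume "u *\<^sub>R a + v *\<^sub>R b + w *\<^sub>R (z / x) *\<^sub>R c = 0"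
    then show "u = 0 \<and> v = 0 \<and> w = 0"
      using indep[of u v "w * (z / x)"] \<open>x \<noteq> 0\<close> \<open>z \<noteq> 0\<close> by simp
  next
    show "a + (z / x) *\<^sub>R c = (- y / x) *\<^sub>R (b + (- 1 / y) *\<^sub>R d)"
      using \<open>x \<noteq> 0\<close> \<open>y \<noteq> 0\<close> by (simp add: d algebra_simps)
  qed (use rep represents_scale[OF rep(3), of "z / x"] represents_scale[OF rep(4), of "- 1 / y"]
      \<open>x \<noteq> 0\<close> \<open>y \<noteq> 0\<close> \<open>z \<noteq> 0\<close> in auto)
  then show ?thesis
    using \<open>x \<noteq> 0\<close> \<open>y \<noteq> 0\<close> \<open>z \<noteq> 0\<close>
    by (intro exI[of _ "z / x"] exI[of _ "- 1 / y"] exI[of _ "- y / x"]) simp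
qed

section \<open>Recurrences on the integer grid\<close>

lemma int_shift_induct:
  fixes P :: "int \<Rightarrow> bool"
  assumes "P i0" "\<And>i. P (i + 1) \<longleftrightarrow> P i"
  shows "P i"
proof (induction i rule: int_induct[where k = i0])
  case (step2 i)
  then show ?case
    using assms(2)[of "i - 1"] by simp
qed (use assms in auto)

lemma all_int_shift:
  fixes P :: "int \<Rightarrow> int \<Rightarrow> bool"
  shows "(\<forall>j. P j (j - 1)) \<longleftrightarrow> (\<forall>j. P (j + 1) j)"
proof safe
  fix j
  show "P (j + 1) j" if "\<forall>j. P j (j - 1)"
    using spec[OF that, of "j + 1"] by simp
  show "P j (j - 1)" if "\<forall>j. P (j + 1) j"
    using spec[OF that, of "j - 1"] by simp
qed

text \<open>A right inverse of each step makes it possible to continue the recurrence to the left of the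
  starting index.\<close>

lemma ex_int_recurrence:
  fixes step unstep :: "int \<Rightarrow> 'b \<Rightarrow> 'b"
  assumes "\<And>i x. step i (unstep i x) = x"
  shows "\<exists>X. X i0 = x0 \<and> (\<forall>i. X (i + 1) = step i (X i))"
proof -
  define up where "up = rec_nat x0 (\<lambda>n. step (i0 + int n))"
  define down where "down = rec_nat x0 (\<lambda>n. unstep (i0 - int n - 1))"
  define X where "X = (\<lambda>i. if i \<ge> i0 then up (nat (i - i0)) else down (nat (i0 - i)))"
  have "X (i + 1) = step i (X i)" for i
  proof (cases "i \<ge> i0")
    case True
    then have "nat (i + 1 - i0) = Suc (nat (i - i0))" by simp
    with True show ?thesis
      by (simp add: X_def up_def)
  next
    case False
    define n where "n = nat (i0 - i - 1)"
    have n: "nat (i0 - i) = Suc n" "i0 - int n - 1 = i"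
      using False by (auto simp: n_def)
    have "X (i + 1) = down n"
    proof (cases "i + 1 = i0")
      case True
      then show ?thesis
        by (simp add: X_def up_def down_def n_def)
    next
      case neq: False
      then have "nat (i0 - (i + 1)) = n" "\<not> i + 1 \<ge> i0"
        using False by (auto simp: n_def)
      then show ?thesis
        by (simp add: X_def)
    qed
    moreover have "X i = unstep i (down n)"
      using False n by (simp add: X_def down_def)
    ultimately show ?thesis
      by (simp add: assms)
  qed
  moreover have "X i0 = x0"
    by (simp add: X_def up_def)
  ultimately show ?thesis by blast
qed

text \<open>The step \<open>y \<mapsto> P i / y\<close> is its own inverse.\<close>

lemma ex_inverting_recurrence:
  fixes P :: "int \<Rightarrow> real"
  assumes "\<And>i. P i \<noteq> 0" "x0 \<noteq> 0"
  shows "\<exists>x. x i0 = x0 \<and> (\<forall>i. x i \<noteq> 0 \<and> x (i + 1) * x i = P i)"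
proof -
  have "P i / (P i / y) = y" for i y
    using assms(1)[of i] by simp
  then obtain x where x: "x i0 = x0" "\<And>i. x (i + 1) = P i / x i"
    using ex_int_recurrence[of "\<lambda>i y. P i / y" "\<lambda>i y. P i / y"] by blast
  have "x i \<noteq> 0" for i
    by (rule int_shift_induct[of _ i0]) (use x assms in auto)
  with x show ?thesis
    by (intro exI[of _ x]) simp
qed

definition inverting_grid ::
  "(int \<Rightarrow> int \<Rightarrow> real) \<Rightarrow> (int \<Rightarrow> int \<Rightarrow> real) \<Rightarrow> (int \<Rightarrow> int \<Rightarrow> real) \<Rightarrow> bool" where
  "inverting_grid P Q r \<longleftrightarrow>
     (\<forall>i j. r (i + 1) j * r i j = P i j \<and> r i (j + 1) * r i j = Q i j)"

lemma inverting_grid_backward: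
  assumes "inverting_grid P Q r"
  shows "r i j * r (i - 1) j = P (i - 1) j" "r i j * r i (j - 1) = Q i (j - 1)"
proof -
  have "r (i - 1 + 1) j * r (i - 1) j = P (i - 1) j" "r i (j - 1 + 1) * r i (j - 1) = Q i (j - 1)"
    using assms unfolding inverting_grid_def by blast+
  then show "r i j * r (i - 1) j = P (i - 1) j" "r i j * r i (j - 1) = Q i (j - 1)"
    by simp_all
qed

lemma inverting_grid_nonzero:
  assumes "inverting_grid P Q r" "\<And>i j. P i j \<noteq> 0"
  shows "r i j \<noteq> 0"
  using assms unfolding inverting_grid_def by (metis mult_zero_right)

text \<open>Fill one row with the horizontal recurrence and then all columns with the vertical one.  The
  compatibility condition says that the product of the horizontal products in two adjacent rows is
  the same for the given data and for the function constructed, so the horizontal recurrence spreads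
  from the first row to all others.\<close>

lemma ex_inverting_grid:
  assumes nonzero: "\<And>i j. P i j \<noteq> 0" "\<And>i j. Q i j \<noteq> 0" "r0 \<noteq> 0"
    and compatible: "\<And>i j. P i (j + 1) * P i j = Q i j * Q (i + 1) j"
  shows "\<exists>r. inverting_grid P Q r \<and> r i0 j0 = r0"
proof -
  obtain x where x: "x i0 = r0" "\<And>i. x i \<noteq> 0" "\<And>i. x (i + 1) * x i = P i j0"
    using ex_inverting_recurrence[of "\<lambda>i. P i j0" r0 i0] nonzero by blast
  have "\<exists>c. c j0 = x i \<and> (\<forall>j. c j \<noteq> 0 \<and> c (j + 1) * c j = Q i j)" for i
    using ex_inverting_recurrence[of "Q i" "x i" j0] nonzero x(2) by blast
  then obtain r where r: "\<And>i. r i j0 = x i" "\<And>i j. r i j \<noteq> 0"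
    "\<And>i j. r i (j + 1) * r i j = Q i j"
    by metis
  have "r (i + 1) j * r i j = P i j" for i j
  proof (rule int_shift_induct[of _ j0])
    show "r (i + 1) j0 * r i j0 = P i j0"
      by (simp add: r(1) x(3))
    fix j
    have "(r (i + 1) (j + 1) * r i (j + 1)) * (r (i + 1) j * r i j) = P i (j + 1) * P i j"
      unfolding compatible by (simp add: r(3)[symmetric])
    then show "r (i + 1) (j + 1) * r i (j + 1) = P i (j + 1) \<longleftrightarrow> r (i + 1) j * r i j = P i j"
      using nonzero(1) by (metis mult_left_cancel mult_right_cancel)
  qed
  with r x(1) show ?thesis
    unfolding inverting_grid_def by blast
qed

lemma inverting_grid_compatible:
  assumes "inverting_grid P Q r"
  shows "P i (j + 1) * P i j = Q i j * Q (i + 1) j"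
proof -
  have "P i j = r (i + 1) j * r i j" "Q i j = r i (j + 1) * r i j" for i j
    using assms by (simp_all add: inverting_grid_def)
  then show ?thesis
    by simp
qed

lemma inverting_grid_unique:
  assumes grids: "inverting_grid P Q r" "inverting_grid P Q s"
    and nonzero: "\<And>i j. P i j \<noteq> 0" "\<And>i j. Q i j \<noteq> 0"
    and start: "r i0 j0 = s i0 j0"
  shows "r = s"
proof -
  have "r (i + 1) j * r i j = s (i + 1) j * s i j" "r i (j + 1) * r i j = s i (j + 1) * s i j"
    "r (i + 1) j * r i j \<noteq> 0" "r i (j + 1) * r i j \<noteq> 0" for i j
    using grids nonzero by (simp_all add: inverting_grid_def)
  then have shift: "r (i + 1) j = s (i + 1) j \<longleftrightarrow> r i j = s i j" "r i (j + 1) = s i (j + 1) \<longleftrightarrow> r i j = s i j" for i j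
    by (metis mult_left_cancel mult_right_cancel mult_eq_0_iff)+
  have row: "r i j0 = s i j0" for i
    by (rule int_shift_induct[of _ i0]) (use start shift in auto)
  have "r i j = s i j" for i j
    by (rule int_shift_induct[of _ j0]) (use row shift in auto)
  then show ?thesis
    by blast
qed

section \<open>The Koenigs condition\<close>

text \<open>Countably many hyperplanes are negligible together and hence do not cover the space.  This yields a
  chart that contains all vertices and diagonal points of a net at once.\<close>

lemma ex_linear_nonzero_on_countable:
  fixes S :: "'a::euclidean_space set"
  assumes "countable S" "0 \<notin> S"
  shows "\<exists>h::'a \<Rightarrow> real. linear h \<and> (\<forall>x\<in>S. h x \<noteq> 0)"
proof -
  have "negligible (\<Union>x\<in>S. {y. x \<bullet> y = 0})"
  proof (rule negligible_countable_Union)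
    show "negligible t" if "t \<in> (\<lambda>x. {y. x \<bullet> y = 0}) ` S" for t
    proof -
      from that obtain x where "x \<in> S" "t = {y. x \<bullet> y = 0}" by blast
      moreover from this assms(2) have "x \<noteq> 0" by blast
      ultimately show ?thesis
        by (simp add: negligible_hyperplane)
    qed
  qed (use assms(1) in simp)
  then have "(\<Union>x\<in>S. {y. x \<bullet> y = 0}) \<noteq> UNIV"
    by auto
  then obtain y where "\<forall>x\<in>S. x \<bullet> y \<noteq> 0"
    by blast
  then show ?thesis
    by (intro exI[of _ "\<lambda>x. x \<bullet> y"]) (auto intro!: linearI simp: inner_add_left)
qed

lemma in_chart_iff:
  assumes "represents v p" "linear h"
  shows "in_chart h p \<longleftrightarrow> h v \<noteq> 0"
  using assms by (auto simp: in_chart_def represents_def span_singleton linear_cmul)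

lemma affine_point_eq:
  assumes "represents v p" "linear h" "h v \<noteq> 0"
  shows "affine_point h p = (1 / h v) *\<^sub>R v"
  unfolding affine_point_def
proof (rule the_equality)
  show "(1 / h v) *\<^sub>R v \<in> subspace_of p \<and> h ((1 / h v) *\<^sub>R v) = 1"
    using assms by (simp add: represents_def span_base span_scale linear_cmul)
next
  fix x assume x: "x \<in> subspace_of p \<and> h x = 1"
  then obtain s where "x = s *\<^sub>R v"
    using assms(1) by (auto simp: represents_def span_singleton)
  with x assms show "x = (1 / h v) *\<^sub>R v"
    by (simp add: linear_cmul field_simps)
qed

text \<open>In the chart, \<open>M\<close> is an affine combination of the points \<open>A\<close> and \<open>B\<close> with weights proportional to
  \<open>x h(a)\<close> and \<open>y h(b)\<close>, and it divides the segment inversely to the weights.\<close>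

lemma length_quotient_eq:
  assumes h: "linear h" "h a \<noteq> 0" "h b \<noteq> 0" "h (x *\<^sub>R a + y *\<^sub>R b) \<noteq> 0"
    and reps: "represents a A" "represents b B" "represents (x *\<^sub>R a + y *\<^sub>R b) M"
    and "A \<noteq> B" "x \<noteq> 0"
  shows "length_quotient h M A B = - (y * h b) / (x * h a)"
proof -
  define a' where "a' = (1 / h a) *\<^sub>R a"
  define b' where "b' = (1 / h b) *\<^sub>R b"
  define m where "m = h (x *\<^sub>R a + y *\<^sub>R b)"
  define u where "u = sgn (b' - a')"
  have m: "m = x * h a + y * h b" "m \<noteq> 0"
    using h by (simp_all add: m_def linear_add linear_cmul)
  have M: "(1 / m) *\<^sub>R (x *\<^sub>R a + y *\<^sub>R b) = (x * h a / m) *\<^sub>R a' + (y * h b / m) *\<^sub>R b'"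
    using h(2,3) by (simp add: a'_def b'_def scaleR_add_right)
  have "a' \<noteq> b'"
  proof
    assume "a' = b'"
    have "b = h b *\<^sub>R b'"
      using h(3) by (simp add: b'_def)
    also have "\<dots> = (h b / h a) *\<^sub>R a"
      unfolding \<open>a' = b'\<close>[symmetric] by (simp add: a'_def)
    finally show False
      using reps(1,2) \<open>A \<noteq> B\<close> point_of_eq_iff[of a b] by (auto simp: represents_iff)
  qed
  then have u: "(b' - a') \<bullet> u \<noteq> 0"
    by (simp add: u_def sgn_div_norm)
  have one: "x * h a / m + y * h b / m = 1"
    using m by (simp add: add_divide_distrib[symmetric])
  have "a' - ((x * h a / m) *\<^sub>R a' + (y * h b / m) *\<^sub>R b')
      = (x * h a / m + y * h b / m) *\<^sub>R a' - ((x * h a / m) *\<^sub>R a' + (y * h b / m) *\<^sub>R b')"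
    using one by simp
  also have "\<dots> = (- (y * h b / m)) *\<^sub>R (b' - a')"
    by (simp add: algebra_simps)
  finally have 1: "oriented_length u ((1 / m) *\<^sub>R (x *\<^sub>R a + y *\<^sub>R b)) a' = - (y * h b / m) * ((b' - a') \<bullet> u)"
    unfolding M oriented_length_def by simp
  have "b' - ((x * h a / m) *\<^sub>R a' + (y * h b / m) *\<^sub>R b')
      = (x * h a / m + y * h b / m) *\<^sub>R b' - ((x * h a / m) *\<^sub>R a' + (y * h b / m) *\<^sub>R b')"
    using one by simp
  also have "\<dots> = (x * h a / m) *\<^sub>R (b' - a')"
    by (simp add: algebra_simps)
  finally have 2: "oriented_length u ((1 / m) *\<^sub>R (x *\<^sub>R a + y *\<^sub>R b)) b' = (x * h a / m) * ((b' - a') \<bullet> u)"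
    unfolding M oriented_length_def by simp
  have "length_quotient h M A B =
      (- (y * h b / m) * ((b' - a') \<bullet> u)) / ((x * h a / m) * ((b' - a') \<bullet> u))"
    unfolding length_quotient_def Let_def affine_point_eq[OF reps(1) h(1,2)]
      affine_point_eq[OF reps(2) h(1,3)] affine_point_eq[OF reps(3) h(1,4)]
    unfolding a'_def[symmetric] b'_def[symmetric] m_def[symmetric] u_def[symmetric] 1 2 ..
  also have "\<dots> = - (y * h b) / (x * h a)"
    using u m(2) h(2) \<open>x \<noteq> 0\<close> by (simp add: divide_simps)
  finally show ?thesis .
qed

context quad_frame
begin

lemma represents_diag_point: "represents (a + c) (diag_point A B C D)"
proof -
  have nz: "a + c \<noteq> 0"
    using indep[of 1 0 1] by auto
  have "meet (join A C) (join B D) = point_of (a + c)"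
  proof (rule meet_eqI[OF _ _ nz])
    show "subspace (join A C)" "subspace (join B D)"
      using represents_vertices by (simp_all add: join_eq_span)
    show "join A C \<inter> join B D = span {a + c}"
    proof (intro set_eqI iffI)
      fix v assume "v \<in> join A C \<inter> join B D"
      then have "v \<in> span {a, c}" "v \<in> span {b, d}"
        using represents_vertices by (auto simp: join_eq_span)
      then obtain x y z w where v: "v = x *\<^sub>R a + y *\<^sub>R c" "v = z *\<^sub>R b + w *\<^sub>R d"
        unfolding mem_span_pair by blast
      then have "x *\<^sub>R a + 0 *\<^sub>R b + y *\<^sub>R c = (w / k) *\<^sub>R a + (z - w) *\<^sub>R b + (w / k) *\<^sub>R c"
        by (simp add: d_eq algebra_simps)
      from coordinates_eq[OF this] have "v = x *\<^sub>R (a + c)"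
        using v(1) by (simp add: scaleR_add_right)
      then show "v \<in> span {a + c}"
        by (simp add: span_base span_scale)
    next
      fix v assume "v \<in> span {a + c}"
      then obtain x where v: "v = x *\<^sub>R (a + c)"
        by (auto simp: span_singleton)
      have "v = x *\<^sub>R a + x *\<^sub>R c"
        by (simp add: v scaleR_add_right)
      moreover have "v = (x * k) *\<^sub>R b + (x * k) *\<^sub>R d"
        by (simp add: v diagonal_relation scaleR_add_right)
      ultimately have "v \<in> span {a, c} \<and> v \<in> span {b, d}"
        unfolding mem_span_pair by blast
      then show "v \<in> join A C \<inter> join B D"
        using represents_vertices by (simp add: join_eq_span)
    qed
  qed
  with nz show ?thesis
    by (simp add: diag_point_def represents_point_of)
qed

lemma opposite_vertices_distinct: "A \<noteq> C" "B \<noteq> D"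
proof -
  interpret R: quad_frame B C D A b c d a "1 / k" by (rule rotate)
  have "c \<noteq> s *\<^sub>R a" "d \<noteq> s *\<^sub>R b" for s
    using indep[of s 0 "- 1"] R.indep[of s 0 "- 1"] by auto
  then show "A \<noteq> C" "B \<noteq> D"
    using represents_vertices by (auto simp: represents_iff point_of_eq_iff)
qed

text \<open>The diagonal point is \<open>a + c = k (b + d)\<close>, with equal weights on the ends of each diagonal, so only
  the chart values remain.  When the frame comes from fixed vectors of the net, these values contain
  the scaling factors of the frame, which carry the geometric information.\<close>

lemma diagonal_length_quotients:
  assumes h: "linear h" "h a \<noteq> 0" "h b \<noteq> 0" "h c \<noteq> 0" "h d \<noteq> 0" "in_chart h (diag_point A B C D)"
  shows "length_quotient h (diag_point A B C D) A C = - h c / h a"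
    and "length_quotient h (diag_point A B C D) C A = - h a / h c"
    and "length_quotient h (diag_point A B C D) B D = - h d / h b"
    and "length_quotient h (diag_point A B C D) D B = - h b / h d"
proof -
  note M = represents_diag_point
  have m: "h (a + c) \<noteq> 0"
    using h(6) unfolding in_chart_iff[OF M h(1)] .
  have ca: "represents (c + a) (diag_point A B C D)" "h (c + a) \<noteq> 0"
    using M m by (simp_all add: add.commute)
  have bd: "represents (k *\<^sub>R b + k *\<^sub>R d) (diag_point A B C D)" "h (k *\<^sub>R b + k *\<^sub>R d) \<noteq> 0"
    using M m by (simp_all add: diagonal_relation scaleR_add_right)
  then have db: "represents (k *\<^sub>R d + k *\<^sub>R b) (diag_point A B C D)" "h (k *\<^sub>R d + k *\<^sub>R b) \<noteq> 0"
    by (simp_all add: add.commute)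
  show "length_quotient h (diag_point A B C D) A C = - h c / h a"
    using length_quotient_eq[of h a c 1 1] M m h represents_vertices opposite_vertices_distinct
    by simp
  show "length_quotient h (diag_point A B C D) C A = - h a / h c"
    using length_quotient_eq[of h c a 1 1] ca h represents_vertices opposite_vertices_distinct
    by simp
  show "length_quotient h (diag_point A B C D) B D = - h d / h b"
    using length_quotient_eq[of h b d k k] bd h represents_vertices opposite_vertices_distinct
      k_nonzero by simp
  show "length_quotient h (diag_point A B C D) D B = - h b / h d"
    using length_quotient_eq[of h d b k k] db h represents_vertices opposite_vertices_distinct
      k_nonzero by simp
qed

end

section \<open>Nets\<close>

lemma point_of_pair_eq_iff:
  assumes "\<And>x y. x *\<^sub>R a - y *\<^sub>R b = 0 \<Longrightarrow> x = 0 \<and> y = 0" "x \<noteq> 0" "x' \<noteq> 0"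
  shows "point_of (x *\<^sub>R a - y *\<^sub>R b) = point_of (x' *\<^sub>R a - y' *\<^sub>R b) \<longleftrightarrow> x * y' = x' * y"
proof -
  have nz: "x *\<^sub>R a - y *\<^sub>R b \<noteq> 0" "x' *\<^sub>R a - y' *\<^sub>R b \<noteq> 0"
    using assms by blast+
  have "x' *\<^sub>R a - y' *\<^sub>R b = s *\<^sub>R (x *\<^sub>R a - y *\<^sub>R b) \<longleftrightarrow> x' = s * x \<and> y' = s * y" for s
  proof
    assume "x' *\<^sub>R a - y' *\<^sub>R b = s *\<^sub>R (x *\<^sub>R a - y *\<^sub>R b)"
    then have "(x' - s * x) *\<^sub>R a - (y' - s * y) *\<^sub>R b = 0"
      by (simp add: algebra_simps)
    from assms(1)[OF this] show "x' = s * x \<and> y' = s * y"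
      by simp
  qed (simp add: algebra_simps)
  then have "point_of (x *\<^sub>R a - y *\<^sub>R b) = point_of (x' *\<^sub>R a - y' *\<^sub>R b) \<longleftrightarrow>
      (\<exists>s. x' = s * x \<and> y' = s * y)"
    unfolding point_of_eq_iff[OF nz] by simp
  also have "\<dots> \<longleftrightarrow> x * y' = x' * y"
    using assms(2) by (auto intro!: exI[of _ "x' / x"] simp: field_simps)
  finally show ?thesis .
qed

lemma edge_point_ratio:
  assumes "represents a A" "represents b B" "p on join A B" "p \<noteq> A" "p \<noteq> B"
  shows "\<exists>r. r \<noteq> 0 \<and> p = point_of (a - r *\<^sub>R b)"
proof -
  obtain v where v: "represents v p"
    using ex_represents by blast
  then have "v \<in> span {a, b}"
    using assms(3) on_subspace_iff[OF v, of "span {a, b}"] join_eq_span[OF assms(1,2)] by simp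
  then obtain x y where xy: "v = x *\<^sub>R a + y *\<^sub>R b"
    by (auto simp: mem_span_pair)
  have nz: "v \<noteq> 0" "a \<noteq> 0" "b \<noteq> 0" and p: "p = point_of v" "A = point_of a" "B = point_of b"
    using v assms(1,2) by (auto simp: represents_iff)
  have "x \<noteq> 0"
    using assms(5) nz point_of_eq_iff[of b v] unfolding p by (auto simp: xy)
  have "y \<noteq> 0"
    using assms(4) nz point_of_eq_iff[of a v] unfolding p by (auto simp: xy)
  have v_eq: "v = x *\<^sub>R (a - (- y / x) *\<^sub>R b)"
    using \<open>x \<noteq> 0\<close> by (simp add: xy algebra_simps)
  then have "a - (- y / x) *\<^sub>R b \<noteq> 0"
    using nz(1) by auto
  then have "p = point_of (a - (- y / x) *\<^sub>R b)"
    unfolding p(1) using point_of_eq_iff[of "a - (- y / x) *\<^sub>R b" v] nz(1) v_eq by metis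
  then show ?thesis
    using \<open>x \<noteq> 0\<close> \<open>y \<noteq> 0\<close> by (intro exI[of _ "- y / x"]) simp
qed

text \<open>One vector \<open>F i j\<close> is fixed at every vertex of the net.  The frame of each quadrilateral uses these
  vectors with factor 1 on its bottom edge, so that the parameter of an inscribed conic is read off
  from its tangency point on this edge; \<open>G\<close> and \<open>H\<close> are the factors at the other two vertices.\<close>

locale framed_net =
  fixes f :: "'a::euclidean_space net" and F :: "int \<Rightarrow> int \<Rightarrow> 'a"
    and G H K :: "int \<Rightarrow> int \<Rightarrow> real"
  assumes frame: "\<And>i j. quad_frame (f i j) (f (i+1) j) (f (i+1) (j+1)) (f i (j+1))
      (F i j) (F (i+1) j) (G i j *\<^sub>R F (i+1) (j+1)) (H i j *\<^sub>R F i (j+1)) (K i j)"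
    and represents_net: "\<And>i j. represents (F i j) (f i j)"
    and G_nonzero: "\<And>i j. G i j \<noteq> 0" and H_nonzero: "\<And>i j. H i j \<noteq> 0"

sublocale framed_net \<subseteq> quad: quad_frame "f i j" "f (i+1) j" "f (i+1) (j+1)" "f i (j+1)"
    "F i j" "F (i+1) j" "G i j *\<^sub>R F (i+1) (j+1)" "H i j *\<^sub>R F i (j+1)" "K i j" for i j
  by (rule frame)

lemma q_net_imp_framed_net:
  assumes "q_net f"
  shows "\<exists>F G H K. framed_net f F G H K"
proof -
  define F where "F i j = (SOME v. represents v (f i j))" for i j
  have F: "represents (F i j) (f i j)" for i j
    unfolding F_def by (rule someI_ex[OF ex_represents])
  have "\<exists>s t k. s \<noteq> 0 \<and> t \<noteq> 0 \<and> quad_frame (f i j) (f (i+1) j) (f (i+1) (j+1)) (f i (j+1))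
      (F i j) (F (i+1) j) (s *\<^sub>R F (i+1) (j+1)) (t *\<^sub>R F i (j+1)) k" for i j
    using assms F by (intro planar_quad_frame) (auto simp: q_net_def)
  then obtain G H K where "\<And>i j. G i j \<noteq> 0 \<and> H i j \<noteq> 0 \<and>
      quad_frame (f i j) (f (i+1) j) (f (i+1) (j+1)) (f i (j+1))
        (F i j) (F (i+1) j) (G i j *\<^sub>R F (i+1) (j+1)) (H i j *\<^sub>R F i (j+1)) (K i j)"
    by metis
  then have "framed_net f F G H K"
    using F by (intro framed_net.intro) auto
  then show ?thesis
    by blast
qed

context framed_net
begin

lemma edge_vectors_independent:
  "x *\<^sub>R F i j - y *\<^sub>R F (i+1) j = 0 \<Longrightarrow> x = 0 \<and> y = 0"
  "x *\<^sub>R F i j - y *\<^sub>R F i (j+1) = 0 \<Longrightarrow> x = 0 \<and> y = 0"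
proof -
  show "x *\<^sub>R F i j - y *\<^sub>R F (i+1) j = 0 \<Longrightarrow> x = 0 \<and> y = 0"
    using quad.indep[of x i j "- y" 0] by simp
  assume 0: "x *\<^sub>R F i j - y *\<^sub>R F i (j+1) = 0"
  interpret R3: quad_frame "f i (j+1)" "f i j" "f (i+1) j" "f (i+1) (j+1)" "H i j *\<^sub>R F i (j+1)"
    "F i j" "F (i+1) j" "G i j *\<^sub>R F (i+1) (j+1)" "1 / (1 / (1 / K i j))"
    by (intro quad_frame.rotate frame)
  show "x = 0 \<and> y = 0"
    using R3.indep[of "- y / H i j" x 0] 0 H_nonzero[of i j] by simp
qed

text \<open>The values that touching forces upon the product of the parameters of two quadrilaterals that are
  neighbours in horizontal or vertical direction.\<close>

definition horizontal_product :: "int \<Rightarrow> int \<Rightarrow> real" where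
  "horizontal_product i j = G i j / H (i + 1) j"

definition vertical_product :: "int \<Rightarrow> int \<Rightarrow> real" where
  "vertical_product i j = G i j / H i j"

lemma products_nonzero: "horizontal_product i j \<noteq> 0" "vertical_product i j \<noteq> 0"
  by (simp_all add: horizontal_product_def vertical_product_def G_nonzero H_nonzero)

abbreviation net_conics :: "(int \<Rightarrow> int \<Rightarrow> real) \<Rightarrow> int \<Rightarrow> int \<Rightarrow> 'a conic" where
  "net_conics r \<equiv> \<lambda>i j. quad.ratio_conic i j (r i j)"

text \<open>The tangency points of the two conics on their common edge are given by coefficient ratios of the
  same two vectors.  On the side of one quadrilateral this ratio is proportional to its parameter, on
  the side of the other to the inverse of its parameter, so equality prescribes the product.\<close>

lemma h_touch_iff:
  assumes "\<And>i j. r i j \<noteq> 0"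
  shows "h_touch f (net_conics r) i j p \<longleftrightarrow>
    p = point_of (F i j - r i j *\<^sub>R F (i+1) j) \<and> r i j * r i (j-1) = vertical_product i (j-1)"
proof -
  have "h_touch f (net_conics r) i j p \<longleftrightarrow> p = point_of (F i j - r i j *\<^sub>R F (i+1) j) \<and>
      p = point_of (H i (j-1) *\<^sub>R F i j - (1 / r i (j-1)) *\<^sub>R G i (j-1) *\<^sub>R F (i+1) j)"
    unfolding h_touch_def h_line_def
    using quad.ratio_conic_tangency_points(1)[where r = "r i j" and i = i and j = j and p = p,
          OF assms]
      quad.ratio_conic_tangency_points(4)[where r = "r i (j-1)" and i = i and j = "j-1" and p = p,
          OF assms] by simp
  also have "\<dots> \<longleftrightarrow> p = point_of (F i j - r i j *\<^sub>R F (i+1) j) \<and>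
      G i (j-1) / r i (j-1) = H i (j-1) * r i j"
    using point_of_pair_eq_iff[of "F i j" "F (i+1) j" 1 "H i (j-1)" "r i j" "G i (j-1) / r i (j-1)",
        OF edge_vectors_independent(1)] H_nonzero
    by auto
  also have "\<dots> \<longleftrightarrow> p = point_of (F i j - r i j *\<^sub>R F (i+1) j) \<and>
      r i j * r i (j-1) = vertical_product i (j-1)"
    using assms[of i "j-1"] H_nonzero[of i "j-1"]
    by (auto simp: vertical_product_def field_simps)
  finally show ?thesis .
qed

lemma v_touch_iff:
  assumes "\<And>i j. r i j \<noteq> 0"
  shows "v_touch f (net_conics r) i j p \<longleftrightarrow>
    p = point_of (F i j - (r i j * H i j) *\<^sub>R F i (j+1)) \<and>
    r i j * r (i-1) j = horizontal_product (i-1) j"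
proof -
  have "v_touch f (net_conics r) i j p \<longleftrightarrow> p = point_of (F i j - r i j *\<^sub>R H i j *\<^sub>R F i (j+1)) \<and>
      p = point_of (F i j - (1 / r (i-1) j) *\<^sub>R G (i-1) j *\<^sub>R F i (j+1))"
    unfolding v_touch_def v_line_def
    using quad.ratio_conic_tangency_points(2)[where r = "r i j" and i = i and j = j and p = p,
          OF assms]
      quad.ratio_conic_tangency_points(3)[where r = "r (i-1) j" and i = "i-1" and j = j and p = p,
          OF assms] by simp
  also have "\<dots> \<longleftrightarrow> p = point_of (F i j - (r i j * H i j) *\<^sub>R F i (j+1)) \<and>
      G (i-1) j / r (i-1) j = r i j * H i j"
    using point_of_pair_eq_iff[of "F i j" "F i (j+1)" 1 1 "r i j * H i j" "G (i-1) j / r (i-1) j",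
        OF edge_vectors_independent(2)]
    by auto
  also have "\<dots> \<longleftrightarrow> p = point_of (F i j - (r i j * H i j) *\<^sub>R F i (j+1)) \<and>
      r i j * r (i-1) j = horizontal_product (i-1) j"
    using assms[of "i-1" j] H_nonzero[of i j]
    by (auto simp: horizontal_product_def field_simps)
  finally show ?thesis .
qed

lemma touching_net_conics_iff:
  assumes r: "\<And>i j. r i j \<noteq> 0"
  shows "touching_inscribed_conics f (net_conics r) \<longleftrightarrow>
    inverting_grid horizontal_product vertical_product r"
proof -
  have "at_quad inscribed f i j (quad.ratio_conic i j (r i j))" for i j
    using r quad.inscribed_iff_ratio_conic by blast
  moreover have
    "(\<exists>p. h_touch f (net_conics r) i j p) \<longleftrightarrow> r i j * r i (j-1) = vertical_product i (j-1)"
    "(\<exists>p. v_touch f (net_conics r) i j p) \<longleftrightarrow> r i j * r (i-1) j = horizontal_product (i-1) j"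
    for i j
    using h_touch_iff[of r i j] v_touch_iff[of r i j] r by auto
  ultimately have "touching_inscribed_conics f (net_conics r) \<longleftrightarrow>
      (\<forall>i j. r i j * r i (j-1) = vertical_product i (j-1)) \<and>
      (\<forall>i j. r i j * r (i-1) j = horizontal_product (i-1) j)"
    unfolding touching_inscribed_conics_def by simp
  moreover have "(\<forall>i j. r i j * r i (j-1) = vertical_product i (j-1)) \<longleftrightarrow>
      (\<forall>i j. r i (j+1) * r i j = vertical_product i j)"
    by (rule iff_allI) (rule all_int_shift[of "\<lambda>j j'. r _ j * r _ j' = vertical_product _ j'"])
  moreover have "(\<forall>j i. r i j * r (i-1) j = horizontal_product (i-1) j) \<longleftrightarrow>
      (\<forall>j i. r (i+1) j * r i j = horizontal_product i j)"
    by (rule iff_allI) (rule all_int_shift[of "\<lambda>i i'. r i _ * r i' _ = horizontal_product i' _"])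
  ultimately show ?thesis
    unfolding inverting_grid_def by blast
qed

lemma touching_iff_inverting_grid:
  "touching_inscribed_conics f \<C> \<longleftrightarrow>
    (\<exists>r. inverting_grid horizontal_product vertical_product r \<and> \<C> = net_conics r)"
proof
  assume touching: "touching_inscribed_conics f \<C>"
  then have "\<forall>i j. \<exists>r. r \<noteq> 0 \<and> \<C> i j = quad.ratio_conic i j r"
    by (simp add: touching_inscribed_conics_def quad.inscribed_iff_ratio_conic)
  then obtain r where r: "\<And>i j. r i j \<noteq> 0" "\<And>i j. \<C> i j = quad.ratio_conic i j (r i j)"
    by metis
  from r(2) have C: "\<C> = net_conics r"
    by (intro ext)
  have "inverting_grid horizontal_product vertical_product r"
    using touching touching_net_conics_iff[OF r(1)] unfolding C by simp
  with C show "\<exists>r. inverting_grid horizontal_product vertical_product r \<and> \<C> = net_conics r"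
    by (intro exI conjI)
next
  assume "\<exists>r. inverting_grid horizontal_product vertical_product r \<and> \<C> = net_conics r"
  then obtain r where r: "inverting_grid horizontal_product vertical_product r"
    and C: "\<C> = net_conics r"
    by (elim exE conjE)
  have "r i j \<noteq> 0" for i j
    using r products_nonzero(1) by (rule inverting_grid_nonzero)
  with r show "touching_inscribed_conics f \<C>"
    unfolding C by (simp add: touching_net_conics_iff)
qed

text \<open>Around a vertex each chart value occurs once in a numerator and once in a denominator.  What is left
  of the product of the four length quotients are the frame factors \<open>G\<close> and \<open>H\<close>, and its being 1 is
  the compatibility of the elementary square formed by the four adjacent quadrilaterals.\<close>

lemma koenigs_net_iff_compatible:
  assumes "q_net f"
  shows "koenigs_net f \<longleftrightarrow> (\<forall>i j. horizontal_product i (j+1) * horizontal_product i j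
    = vertical_product i j * vertical_product (i+1) j)"
proof -
  define M where "M = at_quad diag_point f"
  have chart_net: "in_chart h (f i j) \<longleftrightarrow> h (F i j) \<noteq> 0" if "linear h" for h i j
    by (rule in_chart_iff[OF represents_net that])
  define balanced where
    "balanced i j \<longleftrightarrow> H i j * G i (j-1) = G (i-1) j * H (i-1) (j-1)" for i j
  have vertex: "length_quotient h (M i j) (f (i+1) j) (f i (j+1)) *
      length_quotient h (M (i-1) j) (f i (j+1)) (f (i-1) j) *
      length_quotient h (M (i-1) (j-1)) (f (i-1) j) (f i (j-1)) *
      length_quotient h (M i (j-1)) (f i (j-1)) (f (i+1) j) = 1 \<longleftrightarrow> balanced i j"
    if h: "linear h" and chart: "\<forall>i j. in_chart h (f i j) \<and> in_chart h (M i j)" for h i j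
  proof -
    have F: "h (F i j) \<noteq> 0" for i j
      using chart chart_net[OF h] by blast
    have GF: "h (G i j *\<^sub>R F i' j') \<noteq> 0" "h (H i j *\<^sub>R F i' j') \<noteq> 0" for i j i' j'
      using F G_nonzero H_nonzero by (simp_all add: linear_cmul[OF h])
    have "in_chart h (at_quad diag_point f i j)" for i j
      using chart by (simp add: M_def)
    note quotients = quad.diagonal_length_quotients[OF h F F GF(1) GF(2) this]
    have lq: "length_quotient h (M i j) (f (i+1) j) (f i (j+1)) = - (H i j * h (F i (j+1))) / h (F (i+1) j)"
      "length_quotient h (M (i-1) j) (f i (j+1)) (f (i-1) j) = - h (F (i-1) j) / (G (i-1) j * h (F i (j+1)))"
      "length_quotient h (M (i-1) (j-1)) (f (i-1) j) (f i (j-1)) = - h (F i (j-1)) / (H (i-1) (j-1) * h (F (i-1) j))"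
      "length_quotient h (M i (j-1)) (f i (j-1)) (f (i+1) j) = - (G i (j-1) * h (F (i+1) j)) / h (F i (j-1))"
      using quotients(3)[of i j] quotients(2)[of "i-1" j] quotients(4)[of "i-1" "j-1"]
        quotients(1)[of i "j-1"] by (simp_all add: M_def linear_cmul[OF h])
    have "(- (u * x) / y) * (- z / (v * x)) * (- w / (u' * z)) * (- (v' * y) / w) = 1 \<longleftrightarrow>
        u * v' = v * u'"
      if "x \<noteq> 0" "y \<noteq> 0" "z \<noteq> 0" "w \<noteq> 0" "v \<noteq> 0" "u' \<noteq> 0" for x y z w u v u' v' :: real
    proof -
      have "(- (u * x) / y) * (- z / (v * x)) * (- w / (u' * z)) * (- (v' * y) / w) = (u * v') / (v * u')"
        using that by simp
      with that show ?thesis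
        by auto
    qed
    from this[OF F F F F G_nonzero H_nonzero] show ?thesis
      unfolding lq balanced_def .
  qed
  have "\<exists>h. linear h \<and> (\<forall>i j. in_chart h (f i j) \<and> in_chart h (M i j))"
  proof -
    define m where "m i j = F i j + G i j *\<^sub>R F (i+1) (j+1)" for i j
    have m: "represents (m i j) (M i j)" for i j
      unfolding m_def M_def by (rule quad.represents_diag_point)
    define S where "S = range (\<lambda>(i, j). F i j) \<union> range (\<lambda>(i, j). m i j)"
    have "countable S"
      unfolding S_def by simp
    moreover have "0 \<notin> S"
      unfolding S_def using represents_net m by (force simp: represents_def)
    ultimately obtain h :: "'a \<Rightarrow> real" where h: "linear h" "\<forall>x\<in>S. h x \<noteq> 0"
      using ex_linear_nonzero_on_countable by blast
    have "in_chart h (f i j) \<and> in_chart h (M i j)" for i j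
      using h(2) in_chart_iff[OF m h(1)] chart_net[OF h(1)] by (auto simp: S_def)
    with h(1) show ?thesis
      by blast
  qed
  then have "koenigs_net f \<longleftrightarrow> (\<forall>i j. balanced i j)"
    unfolding koenigs_net_def Let_def M_def[symmetric] using assms vertex by blast
  also have "\<dots> \<longleftrightarrow> (\<forall>i j. balanced (i + 1) (j + 1))"
    by (metis diff_add_cancel)
  also have "\<dots> \<longleftrightarrow> (\<forall>i j. horizontal_product i (j+1) * horizontal_product i j
    = vertical_product i j * vertical_product (i+1) j)"
  proof -
    have "h1 * g2 = g1 * h3 \<longleftrightarrow> (g1 / h1) * (g / h2) = (g / h3) * (g2 / h2)"
      if "h1 \<noteq> 0" "h2 \<noteq> 0" "h3 \<noteq> 0" "g \<noteq> 0" for h1 h2 h3 g g1 g2 :: real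
      using that by (auto simp: divide_simps ac_simps)
    from this[OF H_nonzero H_nonzero H_nonzero G_nonzero] show ?thesis
      unfolding balanced_def horizontal_product_def vertical_product_def by simp
  qed
  finally show ?thesis .
qed

text \<open>A tangency point prescribed on an edge amounts to one prescribed nonzero value of the grid function,
  which determines the function and hence all conics.\<close>

lemma touching_family_if_compatible:
  assumes "\<And>i j. horizontal_product i (j+1) * horizontal_product i j
    = vertical_product i j * vertical_product (i+1) j"
  shows "admits_touching_family f"
proof -
  let ?grid = "inverting_grid horizontal_product vertical_product"
  note grid_nz = inverting_grid_nonzero[where P = horizontal_product, OF _ products_nonzero(1)]
  have h: "h_touch f (net_conics r) i j p \<longleftrightarrow> p = point_of (F i j - r i j *\<^sub>R F (i+1) j)"
    if "?grid r" for r i j p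
    using h_touch_iff[of r i j p, OF grid_nz[OF that]] inverting_grid_backward[OF that] by simp
  have v: "v_touch f (net_conics r) i j p \<longleftrightarrow> p = point_of (F i j - (r i j * H i j) *\<^sub>R F i (j+1))"
    if "?grid r" for r i j p
    using v_touch_iff[of r i j p, OF grid_nz[OF that]] inverting_grid_backward[OF that] by simp
  have unique: "\<exists>!\<C>. touching_inscribed_conics f \<C> \<and> T \<C>"
    if "r0 \<noteq> 0" and T: "\<And>r. ?grid r \<Longrightarrow> T (net_conics r) \<longleftrightarrow> r i j = r0" for T r0 i j
  proof -
    obtain r where r: "?grid r" "r i j = r0"
      using ex_inverting_grid[where P = horizontal_product and Q = vertical_product,
          OF products_nonzero \<open>r0 \<noteq> 0\<close> assms] by blast
    show ?thesis
    proof (rule ex1I[of _ "net_conics r"])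
      show "touching_inscribed_conics f (net_conics r) \<and> T (net_conics r)"
        using r T touching_iff_inverting_grid by blast
      fix \<C> assume C: "touching_inscribed_conics f \<C> \<and> T \<C>"
      then obtain s where s: "?grid s" "\<C> = net_conics s"
        using touching_iff_inverting_grid by blast
      then have "s i j = r i j"
        using C T r by simp
      then have "s = r"
        by (rule inverting_grid_unique[OF s(1) r(1) products_nonzero])
      with s show "\<C> = net_conics r" by simp
    qed
  qed
  show ?thesis
    unfolding admits_touching_family_def
  proof (intro conjI allI impI)
    fix i j p assume p: "p on h_line f i j \<and> p \<noteq> f i j \<and> p \<noteq> f (i+1) j"
    then obtain r0 where r0: "r0 \<noteq> 0" "p = point_of (F i j - r0 *\<^sub>R F (i+1) j)"
      using edge_point_ratio[OF represents_net represents_net] unfolding h_line_def by blast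
    show "\<exists>!\<C>. touching_inscribed_conics f \<C> \<and> h_touch f \<C> i j p"
      using point_of_pair_eq_iff[of "F i j" "F (i+1) j" 1 1 r0, OF edge_vectors_independent(1)]
      by (intro unique[OF r0(1)]) (auto simp: h r0(2))
  next
    fix i j p assume p: "p on v_line f i j \<and> p \<noteq> f i j \<and> p \<noteq> f i (j+1)"
    then obtain s where s: "s \<noteq> 0" "p = point_of (F i j - s *\<^sub>R F i (j+1))"
      using edge_point_ratio[OF represents_net represents_net] unfolding v_line_def by blast
    show "\<exists>!\<C>. touching_inscribed_conics f \<C> \<and> v_touch f \<C> i j p"
      using point_of_pair_eq_iff[of "F i j" "F i (j+1)" 1 1 s, OF edge_vectors_independent(2)]
        s(1) H_nonzero[of i j]
      by (intro unique[of "s / H i j" _ i j]) (auto simp: v s(2) field_simps)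
  qed
qed

lemma touching_family_imp_touching:
  assumes "admits_touching_family f"
  shows "\<exists>\<C>. touching_inscribed_conics f \<C>"
proof -
  (* Any point of an edge-line other than the two vertices will do. *)
  define p where "p = point_of (F 0 0 - F 1 0)"
  have indep: "x *\<^sub>R F 0 0 - y *\<^sub>R F 1 0 = 0 \<Longrightarrow> x = 0 \<and> y = 0" for x y
    using edge_vectors_independent(1)[of x 0 0 y] by simp
  have nz: "F 0 0 - F 1 0 \<noteq> 0" "F 0 0 \<noteq> 0" "F 1 0 \<noteq> 0"
    using indep[of 1 1] indep[of 1 0] indep[of 0 1] by auto
  have "F 0 0 - F 1 0 \<in> span {F 0 0, F 1 0}"
    by (intro span_diff span_base) auto
  then have "p on h_line f 0 0"
    unfolding p_def h_line_def join_eq_span[OF represents_net represents_net]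
    using on_subspace_iff[OF represents_point_of[OF nz(1)]] by simp
  moreover have "F 0 0 \<noteq> s *\<^sub>R (F 0 0 - F 1 0)" "F 1 0 \<noteq> s *\<^sub>R (F 0 0 - F 1 0)" for s
    using indep[of "1 - s" "- s"] indep[of s "1 + s"] by (auto simp: algebra_simps)
  then have "p \<noteq> f 0 0" "p \<noteq> f (0+1) 0"
    using represents_net[of 0 0] represents_net[of 1 0] nz
    by (auto simp: p_def represents_iff point_of_eq_iff)
  ultimately show ?thesis
    using assms unfolding admits_touching_family_def by blast
qed

end

theorem theorem5:
  fixes n :: nat and f :: "int \<Rightarrow> int \<Rightarrow> 'a::euclidean_space proj"
  assumes "n \<ge> 2" and "DIM('a) = n + 1" and "q_net f"
  shows "(koenigs_net f \<longleftrightarrow> (\<exists>\<C>. touching_inscribed_conics f \<C>)) \<and>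
         (koenigs_net f \<longleftrightarrow> admits_touching_family f)"
proof -
  obtain F G H K where "framed_net f F G H K"
    using q_net_imp_framed_net[OF assms(3)] by blast
  then interpret framed_net f F G H K .
  have "koenigs_net f" if "touching_inscribed_conics f \<C>" for \<C>
    using that inverting_grid_compatible
    unfolding koenigs_net_iff_compatible[OF assms(3)] touching_iff_inverting_grid by blast
  moreover have "admits_touching_family f" if "koenigs_net f"
    using that touching_family_if_compatible
    unfolding koenigs_net_iff_compatible[OF assms(3)] by blast
  ultimately show ?thesis
    using touching_family_imp_touching by blast
qed

end
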